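(* Let $n\ge 5$ be an integer, let $R=\mathbb{C}[x,y,z,w]$, and let $I_n\subseteq R$ be the ideal generated by $$(x^n-y^n)(z^n-w^n)xy,\ (x^n-y^n)(z^n-w^n)zw,\ (x^n-z^n)(y^n-w^n)xz,\ (x^n-z^n)(y^n-w^n)yw,\ (x^n-w^n)(y^n-z^n)xw,\ (x^n-w^n)(y^n-z^n)yz.$$ Then $\alpha(I_n^{(m)})=2nm$ for all integers $m\ge 3$.
   Context: For a homogeneous ideal $I$, $\alpha(I)$ denotes the least degree of a nonzero homogeneous element of $I$. The $m$-th symbolic power is $I^{(m)}=\bigcap_{\mathfrak p\in \operatorname{Ass}(R/I)} (I^mR_{\mathfrak p}\cap R)$. *)

theory Defs
  imports Complex_Main "HOL-Library.Poly_Mapping"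
begin

datatype var = X | Y | Z | W

type_synonym mpoly = "(var \<Rightarrow>\<^sub>0 nat) \<Rightarrow>\<^sub>0 complex"

definition Var :: "var \<Rightarrow> mpoly" where
  "Var v = Poly_Mapping.single (Poly_Mapping.single v 1) 1"

definition mon_deg :: "(var \<Rightarrow>\<^sub>0 nat) \<Rightarrow> nat" where
  "mon_deg a = (\<Sum>v\<in>Poly_Mapping.keys a. Poly_Mapping.lookup a v)"

definition homog_of_deg :: "nat \<Rightarrow> mpoly \<Rightarrow> bool" where
  "homog_of_deg d p \<longleftrightarrow> (\<forall>a\<in>Poly_Mapping.keys p. mon_deg a = d)"

definition alpha :: "mpoly set \<Rightarrow> nat" where
  "alpha I = (LEAST d. \<exists>p\<in>I. p \<noteq> 0 \<and> homog_of_deg d p)"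

definition ideal_gen :: "'a::comm_ring_1 set \<Rightarrow> 'a set" where
  "ideal_gen S = {r. \<exists>G c. finite G \<and> G \<subseteq> S \<and> r = (\<Sum>g\<in>G. c g * g)}"

definition ideal_power :: "'a::comm_ring_1 set \<Rightarrow> nat \<Rightarrow> 'a set" where
  "ideal_power I m = ideal_gen {prod_list xs | xs. length xs = m \<and> set xs \<subseteq> I}"

definition is_ideal :: "'a::comm_ring_1 set \<Rightarrow> bool" where
  "is_ideal I \<longleftrightarrow> 0 \<in> I \<and> (\<forall>a\<in>I. \<forall>b\<in>I. a + b \<in> I) \<and> (\<forall>r a. a \<in> I \<longrightarrow> r * a \<in> I)"

definition is_prime_ideal :: "'a::comm_ring_1 set \<Rightarrow> bool" where
  "is_prime_ideal P \<longleftrightarrow> is_ideal P \<and> 1 \<notin> P \<and> (\<forall>a b. a * b \<in> P \<longrightarrow> a \<in> P \<or> b \<in> P)"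

definition Ass :: "'a::comm_ring_1 set \<Rightarrow> 'a set set" where
  "Ass I = {P. is_prime_ideal P \<and> (\<exists>f. P = {r. r * f \<in> I})}"

text \<open>m-th symbolic power: intersection over P in Ass(R/I) of the contractions
  I^m R_P \<inter> R = {f. \<exists>s\<notin>P. s f \<in> I^m}.\<close>
definition symbolic_power :: "'a::comm_ring_1 set \<Rightarrow> nat \<Rightarrow> 'a set" where
  "symbolic_power I m = {f. \<forall>P\<in>Ass I. \<exists>s. s \<notin> P \<and> s * f \<in> ideal_power I m}"

definition I_n :: "nat \<Rightarrow> mpoly set" where
  "I_n n = (let x = Var X; y = Var Y; z = Var Z; w = Var W in
     ideal_gen
      { (x^n - y^n) * (z^n - w^n) * x * y,
        (x^n - y^n) * (z^n - w^n) * z * w,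
        (x^n - z^n) * (y^n - w^n) * x * z,
        (x^n - z^n) * (y^n - w^n) * y * w,
        (x^n - w^n) * (y^n - z^n) * x * w,
        (x^n - w^n) * (y^n - z^n) * y * z })"

end

theory Submission
  imports Defs "HOL-Computational_Algebra.Polynomial" "HOL-Computational_Algebra.Factorial_Ring"
begin

text \<open>
  Put \<open>A = (x\<^sup>n - y\<^sup>n)(z\<^sup>n - w\<^sup>n)\<close>, \<open>B = (x\<^sup>n - z\<^sup>n)(y\<^sup>n - w\<^sup>n)\<close> and
  \<open>C = (x\<^sup>n - w\<^sup>n)(y\<^sup>n - z\<^sup>n)\<close>, so that \<open>B = A + C\<close>.

  Upper bound: if \<open>a + b + c = m\<close> and \<open>na, nb, nc \<ge> m\<close>, then \<open>A\<^sup>a B\<^sup>b C\<^sup>c\<close> lies in the symbolic power.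
  Let \<open>P\<close> be an associated prime. If \<open>P\<close> contains at most one variable, then \<open>A, B, C\<close> lie in \<open>I R\<^sub>P\<close>.
  If it contains exactly two, say \<open>x, y\<close>, then \<open>B z w\<close> is outside \<open>P\<close> and multiplies \<open>x, y\<close> into \<open>I\<close>,
  so \<open>A\<close> lies in \<open>I\<^sup>n R\<^sub>P\<close>. It cannot contain three variables \<open>u, v, t\<close>: \<open>I\<close> is the intersection of
  \<open>(A, C)\<close> with the ideal of the six coordinate lines, and for both ideals \<open>u g, v g, t g \<in> K\<close>
  implies \<open>g \<in> K\<close>.

  Lower bound: the \<open>2n\<close> linear factors \<open>l\<close> of \<open>A\<close> and the \<open>2n\<close> linear factors \<open>l'\<close> of \<open>C\<close> cut out \<open>4n\<^sup>2\<close>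
  distinct lines, whose ideals \<open>(l, l')\<close> are associated primes. If \<open>f\<close> has degree less than \<open>2nm\<close> and
  vanishes to order \<open>m\<close> along all of them, then its restriction to a plane \<open>l = 0\<close> is divisible by
  the \<open>m\<close>-th powers of \<open>2n\<close> distinct linear forms, hence is zero. So \<open>A\<close> divides \<open>f\<close>, and \<open>f / A\<close>
  vanishes to order \<open>m - 1\<close>; induction on \<open>m\<close> gives \<open>f = 0\<close>.
\<close>

subsection \<open>Evaluation homomorphisms\<close>

fun var_rank :: "var \<Rightarrow> nat" where
  "var_rank X = 0" | "var_rank Y = 1" | "var_rank Z = 2" | "var_rank W = 3"

lemma var_rank_inject: "var_rank v = var_rank u \<Longrightarrow> v = u"
  by (cases v; cases u) auto

text \<open>A linear order on the variables makes the library's \<^class>\<open>idom\<close> instance for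
  \<^typ>\<open>mpoly\<close> available.\<close>

instantiation var :: linorder
begin
definition "v \<le> u \<longleftrightarrow> var_rank v \<le> var_rank u"
definition "v < u \<longleftrightarrow> var_rank v < var_rank u"
instance
  by standard (auto simp: less_eq_var_def less_var_def dest: var_rank_inject)
end

lemma UNIV_var: "UNIV = {X, Y, Z, W}"
  using var.exhaust by blast

instance var :: finite
  by standard (simp add: UNIV_var)

definition Const :: "complex \<Rightarrow> mpoly" where
  "Const c = Poly_Mapping.single 0 c"

lemma Const_simps [simp]:
  "Const 0 = 0" "Const 1 = 1" "Const (a + b) = Const a + Const b"
  "Const (a * b) = Const a * Const b" "Const (a - b) = Const a - Const b" "Const (- a) = - Const a"
  by (simp_all add: Const_def mult_single single_add single_diff single_uminus)

lemma Const_power: "Const (a ^ k) = Const a ^ k"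
  by (induction k) auto

lemma Const_eq_0_iff [simp]: "Const c = 0 \<longleftrightarrow> c = 0"
  by (metis Const_def lookup_single_eq lookup_zero single_zero)

lemma mpoly_eq_sum_single:
  fixes p :: mpoly
  shows "p = (\<Sum>a\<in>Poly_Mapping.keys p. Poly_Mapping.single a (Poly_Mapping.lookup p a))"
  by (rule poly_mapping_eqI) (auto simp: lookup_sum lookup_single when_def in_keys_iff)

lemma mpoly_additive_induct [case_names zero single add]:
  fixes p :: mpoly
  assumes "P 0" "\<And>a c. P (Poly_Mapping.single a c)" "\<And>p q. P p \<Longrightarrow> P q \<Longrightarrow> P (p + q)"
  shows "P p"
proof -
  have "P (\<Sum>a\<in>S. Poly_Mapping.single a (Poly_Mapping.lookup p a))" if "finite S" for S
    using that by induction (auto intro: assms)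
  from this[OF finite_keys[of p]] show ?thesis
    by (simp flip: mpoly_eq_sum_single)
qed

lemma exponent_split:
  fixes a :: "var \<Rightarrow>\<^sub>0 nat"
  shows "a = (\<Sum>v\<in>UNIV. Poly_Mapping.single v (Poly_Mapping.lookup a v))"
  by (rule poly_mapping_eqI) (auto simp: lookup_sum lookup_single when_def sum.delta)

lemma single_single: "Poly_Mapping.single (Poly_Mapping.single v k) 1 = Var v ^ k"
proof (induction k)
  case (Suc k)
  then have "Var v ^ Suc k = Var v * Poly_Mapping.single (Poly_Mapping.single v k) 1"
    by simp
  then show ?case
    by (simp add: Var_def mult_single flip: single_add)
qed simp

lemma single_eq_prod:
  "Poly_Mapping.single a c = Const c * (\<Prod>v\<in>UNIV. Var v ^ Poly_Mapping.lookup a v)"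
proof -
  have "Poly_Mapping.single (\<Sum>v\<in>S. Poly_Mapping.single v (Poly_Mapping.lookup a v)) (1::complex)
      = (\<Prod>v\<in>S. Var v ^ Poly_Mapping.lookup a v)" if "finite S" for S
    using that
  proof induction
    case (insert v S)
    then show ?case
      using mult_single[of "Poly_Mapping.single v (Poly_Mapping.lookup a v)" "1::complex"
          "\<Sum>v\<in>S. Poly_Mapping.single v (Poly_Mapping.lookup a v)" 1]
      by (simp add: single_single)
  qed auto
  from this[of UNIV] have "Poly_Mapping.single a (1::complex) = (\<Prod>v\<in>UNIV. Var v ^ Poly_Mapping.lookup a v)"
    using exponent_split[of a] by simp
  then show ?thesis
    using mult_single[of 0 c a 1] by (simp add: Const_def)
qed

lemma mpoly_induct [case_names Const Var add mult]:
  fixes p :: mpoly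
  assumes C: "\<And>c. P (Const c)" and V: "\<And>v. P (Var v)"
    and add: "\<And>p q. P p \<Longrightarrow> P q \<Longrightarrow> P (p + q)"
    and mult: "\<And>p q. P p \<Longrightarrow> P q \<Longrightarrow> P (p * q)"
  shows "P p"
proof (induction p rule: mpoly_additive_induct)
  case zero
  then show ?case using C[of 0] by simp
next
  case (single a c)
  have one: "P 1" using C[of 1] by simp
  have pow: "P (Var v ^ k)" for v k
    by (induction k) (auto intro: one V mult)
  have "P (\<Prod>v\<in>S. Var v ^ Poly_Mapping.lookup a v)" if "finite S" for S
    using that by induction (auto intro: one pow mult)
  then show ?case
    by (simp add: single_eq_prod C mult)
qed (rule add)

text \<open>Both the coefficient map and the target ring are left open, so that one formula yields
  substitution, evaluation at a point and the grading map \<open>scale\<close>.\<close>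

definition evl :: "(complex \<Rightarrow> 'b) \<Rightarrow> (var \<Rightarrow> 'b) \<Rightarrow> mpoly \<Rightarrow> 'b::comm_ring_1" where
  "evl h \<rho> p = (\<Sum>a\<in>Poly_Mapping.keys p.
     h (Poly_Mapping.lookup p a) * (\<Prod>v\<in>UNIV. \<rho> v ^ Poly_Mapping.lookup a v))"

locale coeff_hom =
  fixes h :: "complex \<Rightarrow> 'b::comm_ring_1"
  assumes h0: "h 0 = 0" and h1: "h 1 = 1"
    and h_add: "h (a + b) = h a + h b" and h_mult: "h (a * b) = h a * h b"
begin

lemma evl_superset:
  assumes "finite S" "Poly_Mapping.keys p \<subseteq> S"
  shows "evl h \<rho> p = (\<Sum>a\<in>S. h (Poly_Mapping.lookup p a) * (\<Prod>v\<in>UNIV. \<rho> v ^ Poly_Mapping.lookup a v))"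
  unfolding evl_def using assms by (intro sum.mono_neutral_left) (auto simp: in_keys_iff h0)

lemma evl_0: "evl h \<rho> 0 = 0"
  by (simp add: evl_def)

lemma evl_single: "evl h \<rho> (Poly_Mapping.single a c) = h c * (\<Prod>v\<in>UNIV. \<rho> v ^ Poly_Mapping.lookup a v)"
  by (subst evl_superset[of "{a}"]) (auto simp: h0)

lemma evl_add: "evl h \<rho> (p + q) = evl h \<rho> p + evl h \<rho> q"
proof -
  let ?S = "Poly_Mapping.keys p \<union> Poly_Mapping.keys q"
  have "Poly_Mapping.keys (p + q) \<subseteq> ?S" by (rule keys_add)
  then show ?thesis
    by (simp add: evl_superset[of ?S] lookup_add h_add distrib_right sum.distrib)
qed

lemma evl_mult: "evl h \<rho> (p * q) = evl h \<rho> p * evl h \<rho> q"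
proof (induction p rule: mpoly_additive_induct)
  case (single a c)
  show ?case
  proof (induction q rule: mpoly_additive_induct)
    case (single b d)
    show ?case
      by (simp add: mult_single evl_single h_mult lookup_add power_add prod.distrib mult_ac)
  qed (simp_all add: evl_0 evl_add distrib_left)
qed (simp_all add: evl_0 evl_add distrib_right)

lemma evl_Const: "evl h \<rho> (Const c) = h c"
  by (simp add: Const_def evl_single)

lemma evl_1: "evl h \<rho> 1 = 1"
  using evl_Const[of \<rho> 1] by (simp add: h1)

lemma evl_Var: "evl h \<rho> (Var v) = \<rho> v"
proof -
  have "(\<Prod>u\<in>UNIV. \<rho> u ^ Poly_Mapping.lookup (Poly_Mapping.single v (1::nat)) u)
      = (\<Prod>u\<in>UNIV. if u = v then \<rho> u else 1)"
    by (intro prod.cong) (auto simp: lookup_single)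
  then show ?thesis
    unfolding Var_def evl_single by (simp add: h1)
qed

lemma evl_minus: "evl h \<rho> (- p) = - evl h \<rho> p"
  using evl_add[of \<rho> p "- p"] by (simp add: evl_0 add_eq_0_iff2)

lemma evl_diff: "evl h \<rho> (p - q) = evl h \<rho> p - evl h \<rho> q"
  using evl_add[of \<rho> p "- q"] by (simp add: evl_minus)

lemma evl_power: "evl h \<rho> (p ^ k) = evl h \<rho> p ^ k"
  by (induction k) (auto simp: evl_1 evl_mult)

lemma evl_sum: "evl h \<rho> (sum f S) = (\<Sum>i\<in>S. evl h \<rho> (f i))"
  by (induction S rule: infinite_finite_induct) (auto simp: evl_0 evl_add)

lemma evl_prod: "evl h \<rho> (prod f S) = (\<Prod>i\<in>S. evl h \<rho> (f i))"
  by (induction S rule: infinite_finite_induct) (auto simp: evl_1 evl_mult)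

lemmas evl_simps = evl_0 evl_1 evl_add evl_mult evl_Const evl_Var evl_minus evl_diff evl_power
  evl_sum evl_prod

end

definition subst :: "(var \<Rightarrow> mpoly) \<Rightarrow> mpoly \<Rightarrow> mpoly" where
  "subst = evl Const"

definition eval_at :: "(var \<Rightarrow> complex) \<Rightarrow> mpoly \<Rightarrow> complex" where
  "eval_at = evl (\<lambda>c. c)"

text \<open>Substituting \<open>v T\<close> for every variable \<open>v\<close>: a polynomial \<open>p\<close> is homogeneous of degree \<open>d\<close>
  iff its image is \<open>p T\<^sup>d\<close>.\<close>

definition scale :: "mpoly \<Rightarrow> mpoly poly" where
  "scale = evl (\<lambda>c. [:Const c:]) (\<lambda>v. monom (Var v) 1)"

interpretation subst: coeff_hom Const
  by standard simp_all

interpretation eval_at: coeff_hom "\<lambda>c::complex. c"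
  by standard simp_all

interpretation scale: coeff_hom "\<lambda>c. [:Const c:]"
  by standard (simp_all add: one_pCons)

lemmas subst_simps [simp] = subst.evl_simps[folded subst_def]
lemmas eval_at_simps [simp] = eval_at.evl_simps[folded eval_at_def]
lemmas scale_simps [simp] = scale.evl_simps[of "\<lambda>v. monom (Var v) 1", folded scale_def]

lemma subst_single: "subst \<rho> (Poly_Mapping.single a c) = Const c * (\<Prod>v\<in>UNIV. \<rho> v ^ Poly_Mapping.lookup a v)"
  by (simp add: subst_def subst.evl_single)

lemma eval_at_neq_0D: "eval_at \<rho> p \<noteq> 0 \<Longrightarrow> p \<noteq> 0"
  by auto

lemma eval_at_dvd: "p dvd q \<Longrightarrow> eval_at \<rho> p = 0 \<Longrightarrow> eval_at \<rho> q = 0"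
  by (auto elim!: dvdE)

lemma Var_neq_0 [simp]: "Var v \<noteq> 0"
  by (rule eval_at_neq_0D[of "\<lambda>_. 1"]) simp

text \<open>The polynomials congruent to their substitution modulo the ideal generated by
  \<open>l\<close> and \<open>l'\<close> contain the constants and are closed under sums and
  products, so checking the variables suffices.\<close>

lemma subst_congruence:
  assumes "\<And>v. \<exists>a b. Var v - \<rho> v = a * l + b * l'"
  shows "\<exists>a b. p - subst \<rho> p = a * l + b * l'"
proof (induction p rule: mpoly_induct)
  case (Const c)
  show ?case by (intro exI[of _ 0]) simp
next
  case (Var v)
  then show ?case using assms by simp
next
  case (add p q)
  then obtain a b c d where "p - subst \<rho> p = a * l + b * l'" "q - subst \<rho> q = c * l + d * l'"
    by blast
  then have "(p + q) - subst \<rho> (p + q) = (a + c) * l + (b + d) * l'"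
    by (simp add: algebra_simps)
  then show ?case by blast
next
  case (mult p q)
  then obtain a b c d where p: "p - subst \<rho> p = a * l + b * l'" and q: "q - subst \<rho> q = c * l + d * l'"
    by blast
  \<comment> \<open>The product rule \<open>p q - p' q' = (p - p') q + p' (q - q')\<close>, with
    primes for substitution.\<close>
  have "p * q - subst \<rho> (p * q)
      = (a * l + b * l') * q + subst \<rho> p * (c * l + d * l')"
    unfolding p[symmetric] q[symmetric] by (simp add: algebra_simps)
  also have "\<dots> = (a * q + subst \<rho> p * c) * l + (b * q + subst \<rho> p * d) * l'"
    by (simp add: algebra_simps)
  finally show ?case by blast
qed

lemma subst_congruence_dvd:
  assumes "\<And>v. l dvd Var v - \<rho> v"
  shows "l dvd p - subst \<rho> p"
proof -
  have "\<exists>a b. p - subst \<rho> p = a * l + b * 0"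
    by (rule subst_congruence) (metis assms dvd_def mult.commute mult_zero_right add.right_neutral)
  then show ?thesis by auto
qed

subsection \<open>Homogeneous polynomials\<close>

lemma mon_deg_eq: "mon_deg a = (\<Sum>v\<in>UNIV. Poly_Mapping.lookup a v)"
  unfolding mon_deg_def by (intro sum.mono_neutral_left) (auto simp: in_keys_iff)

text \<open>The coefficient of \<open>T^k\<close> in \<open>scale p\<close> is the homogeneous
  component of \<open>p\<close> of degree \<open>k\<close>.\<close>

lemma lookup_coeff_scale:
  "Poly_Mapping.lookup (coeff (scale p) k) a = (if mon_deg a = k then Poly_Mapping.lookup p a else 0)"
proof (induction p rule: mpoly_additive_induct)
  case (single b c)
  have "(\<Prod>v\<in>S. monom (Var v) (Suc 0) ^ Poly_Mapping.lookup b v)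
      = monom (\<Prod>v\<in>S. Var v ^ Poly_Mapping.lookup b v) (\<Sum>v\<in>S. Poly_Mapping.lookup b v)" if "finite S" for S
    using that by induction (auto simp: monom_power mult_monom)
  then have "scale (Poly_Mapping.single b c) = monom (Poly_Mapping.single b c) (mon_deg b)"
    unfolding scale_def scale.evl_single by (simp add: mon_deg_eq single_eq_prod smult_monom)
  then show ?case
    by (auto simp: lookup_single when_def)
qed (auto simp: lookup_add)

lemma homog_of_deg_iff_scale: "homog_of_deg d p \<longleftrightarrow> scale p = monom p d"
proof
  assume "homog_of_deg d p"
  then show "scale p = monom p d"
    by (intro poly_eqI poly_mapping_eqI)
      (auto simp: lookup_coeff_scale homog_of_deg_def in_keys_iff)
next
  assume *: "scale p = monom p d"
  show "homog_of_deg d p"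
    unfolding homog_of_deg_def
  proof
    fix a assume "a \<in> Poly_Mapping.keys p"
    then show "mon_deg a = d"
      using lookup_coeff_scale[of p d a] by (auto simp: * in_keys_iff split: if_splits)
  qed
qed

lemma homog_Var [simp]: "homog_of_deg 1 (Var v)"
  by (simp add: homog_of_deg_iff_scale)

lemma homog_mult: "homog_of_deg d p \<Longrightarrow> homog_of_deg e q \<Longrightarrow> homog_of_deg (d + e) (p * q)"
  by (simp add: homog_of_deg_iff_scale mult_monom)

lemma homog_add: "homog_of_deg d p \<Longrightarrow> homog_of_deg d q \<Longrightarrow> homog_of_deg d (p + q)"
  by (simp add: homog_of_deg_iff_scale add_monom)

lemma homog_diff: "homog_of_deg d p \<Longrightarrow> homog_of_deg d q \<Longrightarrow> homog_of_deg d (p - q)"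
  by (simp add: homog_of_deg_iff_scale diff_monom)

lemma homog_Const: "homog_of_deg 0 (Const c)"
  by (simp add: homog_of_deg_iff_scale monom_0)

lemma homog_power: "homog_of_deg d p \<Longrightarrow> homog_of_deg (d * k) (p ^ k)"
  by (simp add: homog_of_deg_iff_scale monom_power)

lemma homog_prod: "(\<And>i. i \<in> S \<Longrightarrow> homog_of_deg (d i) (f i)) \<Longrightarrow> homog_of_deg (\<Sum>i\<in>S. d i) (\<Prod>i\<in>S. f i)"
proof (induction S rule: infinite_finite_induct)
  case (insert i S)
  then show ?case by (simp add: homog_mult)
qed (use homog_Const[of 1] in auto)

text \<open>Since \<open>scale\<close> is multiplicative, \<open>p T^e\<close> times
  \<open>scale q\<close> is \<open>p q T^d\<close>. Comparing coefficients of powers of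
  \<open>T\<close> and cancelling \<open>p\<close> in the domain gives both claims.\<close>

lemma homog_factor:
  assumes "homog_of_deg d (p * q)" "homog_of_deg e p" "p * q \<noteq> 0"
  shows "e \<le> d" "homog_of_deg (d - e) q"
proof -
  from assms have nz: "p \<noteq> 0" "q \<noteq> 0" by auto
  have eq: "monom p e * scale q = monom (p * q) d"
    using assms by (simp add: homog_of_deg_iff_scale)
  have c: "coeff (monom p e * scale q) k = (if k < e then 0 else p * coeff (scale q) (k - e))" for k
    by (simp add: coeff_monom_mult)
  show le: "e \<le> d"
    using c[of d] nz unfolding eq by (auto split: if_splits)
  have "coeff (scale q) k = coeff (monom q (d - e)) k" for k
    using c[of "k + e"] le nz unfolding eq by (auto split: if_splits)
  then show "homog_of_deg (d - e) q"
    by (auto simp: homog_of_deg_iff_scale intro: poly_eqI)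
qed

lemma homog_0_imp_Const:
  assumes "homog_of_deg 0 p"
  shows "\<exists>c. p = Const c"
proof -
  have "a = 0" if "a \<in> Poly_Mapping.keys p" for a
  proof (rule poly_mapping_eqI)
    fix v
    show "Poly_Mapping.lookup a v = Poly_Mapping.lookup 0 v"
      using assms that by (auto simp: homog_of_deg_def mon_deg_eq)
  qed
  then have "p = Const (Poly_Mapping.lookup p 0)"
    by (intro poly_mapping_eqI) (auto simp: Const_def lookup_single when_def in_keys_iff)
  then show ?thesis by blast
qed

lemma homog_sum: "(\<And>i. i \<in> S \<Longrightarrow> homog_of_deg d (f i)) \<Longrightarrow> homog_of_deg d (\<Sum>i\<in>S. f i)"
proof (induction S rule: infinite_finite_induct)
  case (insert i S)
  then show ?case by (simp add: homog_add)
qed (auto simp: homog_of_deg_def)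

lemma homog_subst:
  assumes "\<And>v. homog_of_deg 1 (\<rho> v)" "homog_of_deg d p"
  shows "homog_of_deg d (subst \<rho> p)"
  unfolding subst_def evl_def
proof (rule homog_sum)
  fix a assume "a \<in> Poly_Mapping.keys p"
  then have d: "d = 0 + (\<Sum>v\<in>UNIV. 1 * Poly_Mapping.lookup a v)"
    using assms(2) by (simp add: homog_of_deg_def mon_deg_eq)
  show "homog_of_deg d (Const (Poly_Mapping.lookup p a) * (\<Prod>v\<in>UNIV. \<rho> v ^ Poly_Mapping.lookup a v))"
    by (subst d) (intro homog_mult homog_Const homog_prod homog_power assms(1))
qed

lemma homog_dvd_le:
  assumes "q dvd p" "homog_of_deg d p" "homog_of_deg e q" "p \<noteq> 0"
  shows "e \<le> d"
  using assms by (auto elim!: dvdE intro: homog_factor(1))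

subsection \<open>Linear forms\<close>

text \<open>That \<open>b\<close> is a non-zero-divisor modulo \<open>a\<close>. Unlike coprimality,
  this passes to products in either argument without appeal to unique factorization.\<close>

definition nzd_mod :: "'a::idom \<Rightarrow> 'a \<Rightarrow> bool" where
  "nzd_mod a b \<longleftrightarrow> (\<forall>u. a dvd u * b \<longrightarrow> a dvd u)"

lemma nzd_modD: "nzd_mod a b \<Longrightarrow> a dvd u * b \<Longrightarrow> a dvd u"
  by (simp only: nzd_mod_def)

lemma nzd_mod_prime: "prime_elem p \<Longrightarrow> \<not> p dvd b \<Longrightarrow> nzd_mod p b"
  by (auto simp: nzd_mod_def prime_elem_dvd_mult_iff)

lemma nzd_mod_1 [simp]: "nzd_mod 1 b" "nzd_mod b 1"
  by (simp_all add: nzd_mod_def)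

lemma nzd_mod_mult_left:
  assumes "nzd_mod a b" "nzd_mod a' b" "a \<noteq> 0"
  shows "nzd_mod (a * a') b"
  unfolding nzd_mod_def
proof (intro allI impI)
  fix u assume u: "a * a' dvd u * b"
  then have "a dvd u * b" by (rule dvd_mult_left)
  with assms(1) have "a dvd u" by (rule nzd_modD)
  then obtain v where v: "u = a * v" by (elim dvdE)
  then have "a' dvd v * b" using u assms(3) by (simp add: mult.assoc)
  with assms(2) have "a' dvd v" by (rule nzd_modD)
  then show "a * a' dvd u" by (simp add: v)
qed

lemma nzd_mod_mult_right: "nzd_mod a b \<Longrightarrow> nzd_mod a b' \<Longrightarrow> nzd_mod a (b * b')"
  unfolding nzd_mod_def by (metis mult.assoc)

lemma nzd_mod_power_left: "nzd_mod p b \<Longrightarrow> p \<noteq> 0 \<Longrightarrow> nzd_mod (p ^ m) b"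
  by (induction m) (auto intro: nzd_mod_mult_left)

lemma nzd_mod_power_right: "nzd_mod a b \<Longrightarrow> nzd_mod a (b ^ m)"
  by (induction m) (auto intro: nzd_mod_mult_right)

lemma nzd_mod_prod_left:
  "(\<And>i. i \<in> S \<Longrightarrow> nzd_mod (p i) b \<and> p i \<noteq> 0) \<Longrightarrow> nzd_mod (\<Prod>i\<in>S. p i) b"
  by (induction S rule: infinite_finite_induct) (auto intro: nzd_mod_mult_left)

lemma nzd_mod_prod_right:
  "(\<And>i. i \<in> S \<Longrightarrow> nzd_mod a (p i)) \<Longrightarrow> nzd_mod a (\<Prod>i\<in>S. p i)"
  by (induction S rule: infinite_finite_induct) (auto intro: nzd_mod_mult_right)

text \<open>Prime powers are split off one at a time: the product of the others is a
  non-zero-divisor modulo \<open>p i ^ m\<close>, so \<open>p i ^ m\<close> must divide the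
  cofactor.\<close>

lemma prod_prime_powers_dvd:
  fixes p :: "'i \<Rightarrow> 'a::idom"
  assumes "finite S" "\<And>i. i \<in> S \<Longrightarrow> prime_elem (p i)"
    and "\<And>i j. i \<in> S \<Longrightarrow> j \<in> S \<Longrightarrow> i \<noteq> j \<Longrightarrow> \<not> p i dvd p j"
    and "\<And>i. i \<in> S \<Longrightarrow> p i ^ m dvd f"
  shows "(\<Prod>i\<in>S. p i ^ m) dvd f"
  using assms
proof (induction S)
  case (insert i S)
  then have "(\<Prod>j\<in>S. p j ^ m) dvd f"
    by simp
  then obtain g where g: "f = g * (\<Prod>j\<in>S. p j ^ m)"
    by (metis dvdE mult.commute)
  have "nzd_mod (p i ^ m) (\<Prod>j\<in>S. p j ^ m)"
    using insert.prems insert.hyps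
    by (intro nzd_mod_prod_right nzd_mod_power_right nzd_mod_power_left nzd_mod_prime prime_elem_not_zeroI) auto
  then have "p i ^ m dvd g"
    by (rule nzd_modD) (use insert.prems(3)[of i] g in simp)
  then show ?case
    using insert.hyps by (simp add: g mult_dvd_mono)
qed auto

text \<open>\<open>\<rho>\<close> eliminates one variable on the plane \<open>l = 0\<close>, so \<open>subst \<rho>\<close> is the restriction to that plane.\<close>

definition linear_form :: "mpoly \<Rightarrow> (var \<Rightarrow> mpoly) \<Rightarrow> bool" where
  "linear_form l \<rho> \<longleftrightarrow> l \<noteq> 0 \<and> homog_of_deg 1 l \<and> subst \<rho> l = 0 \<and> (\<forall>v. homog_of_deg 1 (\<rho> v)) \<and>
     (\<forall>v. l dvd Var v - \<rho> v)"

text \<open>Restriction to the plane is a ring homomorphism with kernel generated by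
  \<open>l\<close>. Its target is a domain, which is why \<open>l\<close> is prime.\<close>

lemma linear_form_dvd_iff:
  assumes "linear_form l \<rho>"
  shows "l dvd p \<longleftrightarrow> subst \<rho> p = 0"
proof
  assume "l dvd p"
  then show "subst \<rho> p = 0" using assms by (auto simp: linear_form_def elim!: dvdE)
next
  assume "subst \<rho> p = 0"
  then show "l dvd p"
    using subst_congruence_dvd[of l \<rho> p] assms by (auto simp: linear_form_def)
qed

lemma linear_form_prime:
  assumes "linear_form l \<rho>"
  shows "prime_elem l"
  using assms by (intro prime_elemI) (auto simp: linear_form_dvd_iff[OF assms] linear_form_def)

lemma eval_at_subst:
  assumes "linear_form l \<rho>" "eval_at pt l = 0"
  shows "eval_at pt (subst \<rho> p) = eval_at pt p"
proof -
  have "l dvd p - subst \<rho> p"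
    using assms by (intro subst_congruence_dvd) (simp add: linear_form_def)
  then show ?thesis
    using eval_at_dvd[OF _ assms(2)] by fastforce
qed

section \<open>Ideals of lines and their powers\<close>

definition ideal2 :: "mpoly \<Rightarrow> mpoly \<Rightarrow> mpoly set" where
  "ideal2 l l' = {a * l + b * l' | a b. True}"

lemma ideal2I: "a * l + b * l' \<in> ideal2 l l'"
  by (auto simp: ideal2_def)

lemma is_ideal_ideal2: "is_ideal (ideal2 l l')"
  unfolding is_ideal_def
proof (intro conjI allI ballI impI)
  show "0 \<in> ideal2 l l'" using ideal2I[of 0 l 0 l'] by simp
next
  fix p q assume "p \<in> ideal2 l l'" "q \<in> ideal2 l l'"
  then obtain a b c d where "p = a * l + b * l'" "q = c * l + d * l'"
    by (auto simp: ideal2_def)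
  then have "p + q = (a + c) * l + (b + d) * l'" by (simp add: algebra_simps)
  then show "p + q \<in> ideal2 l l'" by (simp only: ideal2I)
next
  fix r p assume "p \<in> ideal2 l l'"
  then obtain a b where "p = a * l + b * l'"
    by (auto simp: ideal2_def)
  then have "r * p = (r * a) * l + (r * b) * l'" by (simp add: algebra_simps)
  then show "r * p \<in> ideal2 l l'" by (simp only: ideal2I)
qed

lemma eval_at_ideal2: "eval_at pt l = 0 \<Longrightarrow> eval_at pt l' = 0 \<Longrightarrow> p \<in> ideal2 l l' \<Longrightarrow> eval_at pt p = 0"
  by (auto simp: ideal2_def)

text \<open>Modulo \<open>l\<close> the ideal becomes principal, generated by the restriction of
  \<open>l'\<close>; membership turns into divisibility on the plane.\<close>

lemma ideal2_iff:
  assumes "linear_form l \<rho>"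
  shows "p \<in> ideal2 l l' \<longleftrightarrow> subst \<rho> l' dvd subst \<rho> p"
proof
  assume "p \<in> ideal2 l l'"
  then show "subst \<rho> l' dvd subst \<rho> p"
    using assms by (auto simp: ideal2_def linear_form_def)
next
  assume "subst \<rho> l' dvd subst \<rho> p"
  then obtain t where t: "subst \<rho> p = subst \<rho> l' * t" by (elim dvdE)
  have "l dvd p - subst \<rho> p" "l dvd l' - subst \<rho> l'"
    using assms by (auto intro!: subst_congruence_dvd simp: linear_form_def)
  then obtain u v where "p - subst \<rho> p = l * u" "l' - subst \<rho> l' = l * v"
    by (elim dvdE)
  then have "p = subst \<rho> p + l * u" "subst \<rho> l' = l' - l * v"
    by (simp_all add: algebra_simps)
  then have "p = (u - v * t) * l + t * l'"
    using t by (simp add: algebra_simps)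
  then show "p \<in> ideal2 l l'" by (simp only: ideal2I)
qed

lemma is_prime_ideal_ideal2:
  assumes "linear_form l \<rho>" "prime_elem (subst \<rho> l')"
  shows "is_prime_ideal (ideal2 l l')"
  unfolding is_prime_ideal_def
  using assms(2) is_ideal_ideal2
  by (auto simp: ideal2_iff[OF assms(1)] prime_elem_dvd_mult_iff prime_elem_not_unit)

text \<open>The power \<open>(l, l')\<^sup>m\<close>, in the form \<open>(l, l')\<^sup>m\<^sup>+\<^sup>1 = l (l, l')\<^sup>m + (l'\<^sup>m\<^sup>+\<^sup>1)\<close>.\<close>

fun pow2 :: "mpoly \<Rightarrow> mpoly \<Rightarrow> nat \<Rightarrow> mpoly set" where
  "pow2 l l' 0 = UNIV"
| "pow2 l l' (Suc m) = {a * l + b * l' ^ Suc m | a b. a \<in> pow2 l l' m}"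

lemma pow2_SucI: "a \<in> pow2 l l' m \<Longrightarrow> a * l + b * l' ^ Suc m \<in> pow2 l l' (Suc m)"
  by auto

lemma pow2_add: "p \<in> pow2 l l' m \<Longrightarrow> q \<in> pow2 l l' m \<Longrightarrow> p + q \<in> pow2 l l' m"
proof (induction m arbitrary: p q)
  case (Suc m)
  then obtain a b c d where "p = a * l + b * l' ^ Suc m" "q = c * l + d * l' ^ Suc m"
    "a \<in> pow2 l l' m" "c \<in> pow2 l l' m"
    by auto
  then show ?case
    using pow2_SucI[OF Suc.IH, of a c "b + d"] by (simp add: algebra_simps)
qed auto

lemma pow2_mult: "p \<in> pow2 l l' m \<Longrightarrow> r * p \<in> pow2 l l' m"
proof (induction m arbitrary: p)
  case (Suc m)
  then obtain a b where "p = a * l + b * l' ^ Suc m" "a \<in> pow2 l l' m"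
    by auto
  then show ?case
    using pow2_SucI[OF Suc.IH, of a "r * b"] by (simp add: algebra_simps)
qed auto

lemma pow2_power: "b * l' ^ m \<in> pow2 l l' m"
proof (induction m)
  case (Suc m)
  have "0 \<in> pow2 l l' m" using pow2_mult[OF Suc, of 0] by simp
  from pow2_SucI[OF this, of b] show ?case by simp
qed auto

text \<open>The nested form of \<open>pow2\<close> treats its two generators asymmetrically.
  Multiplication by \<open>l\<close> is built in; for \<open>l'\<close> the factor is pushed into
  the coefficient of \<open>l\<close> by induction.\<close>

lemma pow2_mult_snd: "p \<in> pow2 l l' m \<Longrightarrow> l' * p \<in> pow2 l l' (Suc m)"
proof (induction m arbitrary: p)
  case 0
  show ?case using pow2_SucI[of 0 l l' 0 p] by (simp add: mult.commute)
next
  case (Suc m)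
  then obtain a b where "p = a * l + b * l' ^ Suc m" "a \<in> pow2 l l' m"
    by auto
  then show ?case
    using pow2_SucI[OF Suc.IH, of a b] by (simp add: algebra_simps)
qed

lemma ideal2_mult_pow2:
  assumes "q \<in> ideal2 l l'" "p \<in> pow2 l l' m"
  shows "q * p \<in> pow2 l l' (Suc m)"
proof -
  obtain a b where q: "q = a * l + b * l'" using assms(1) by (auto simp: ideal2_def)
  have pl: "p * l \<in> pow2 l l' (Suc m)"
    using pow2_SucI[OF assms(2), of 0] by (simp del: pow2.simps)
  have "a * (p * l) + b * (l' * p) \<in> pow2 l l' (Suc m)"
    by (rule pow2_add[OF pow2_mult[OF pl] pow2_mult[OF pow2_mult_snd[OF assms(2)]]])
  then show ?thesis by (simp add: q algebra_simps del: pow2.simps)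
qed

lemma ideal_power_subset_pow2:
  assumes "I \<subseteq> ideal2 l l'"
  shows "ideal_power I m \<subseteq> pow2 l l' m"
proof
  have *: "prod_list xs \<in> pow2 l l' (length xs)" if "set xs \<subseteq> I" for xs
    using that by (induction xs) (use assms in \<open>auto intro!: ideal2_mult_pow2 simp del: pow2.simps(2)\<close>)
  fix p assume "p \<in> ideal_power I m"
  then obtain G c where G: "finite G" "G \<subseteq> {prod_list xs |xs. length xs = m \<and> set xs \<subseteq> I}"
    and p: "p = (\<Sum>g\<in>G. c g * g)"
    by (auto simp: ideal_power_def ideal_gen_def)
  from G have "(\<Sum>g\<in>G. c g * g) \<in> pow2 l l' m"
  proof induction
    case empty
    show ?case using pow2_mult[OF pow2_power[of 0 l' m l], of 0] by simp
  next
    case (insert g G)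
    then have "g \<in> pow2 l l' m" using * by auto
    then show ?case using insert by (auto intro: pow2_add pow2_mult)
  qed
  then show "p \<in> pow2 l l' m" by (simp add: p)
qed

text \<open>On the plane \<open>l = 0\<close> only the summand with \<open>l' ^ m\<close>
  survives.\<close>

lemma subst_pow2:
  assumes "linear_form l \<rho>" "p \<in> pow2 l l' m"
  shows "subst \<rho> l' ^ m dvd subst \<rho> p"
  using assms by (cases m) (auto simp: linear_form_def)

text \<open>In \<open>l * p = a * l + b * l' ^ Suc m\<close> the prime \<open>l\<close> must divide
  \<open>b\<close>, because it does not divide \<open>l'\<close>. Cancelling \<open>l\<close> leaves
  \<open>a\<close> plus a multiple of \<open>l' ^ m\<close>.\<close>

lemma pow2_cancel:
  assumes "linear_form l \<rho>" "\<not> l dvd l'" "l * p \<in> pow2 l l' (Suc m)"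
  shows "p \<in> pow2 l l' m"
proof -
  obtain a b where ab: "l * p = a * l + b * l' ^ Suc m" "a \<in> pow2 l l' m"
    using assms(3) by auto
  have "l dvd b * l' ^ Suc m"
    using ab(1) by (metis dvd_triv_left dvd_triv_right dvd_add_right_iff)
  then obtain b' where b': "b = l * b'"
    using assms(2) linear_form_prime[OF assms(1)]
    by (metis dvdE prime_elem_dvd_mult_iff prime_elem_dvd_power)
  have "l * p = l * (a + b' * l' * l' ^ m)"
    using ab(1) by (simp add: b' algebra_simps)
  then have "p = a + b' * l' * l' ^ m"
    using assms(1) by (simp add: linear_form_def)
  then show ?thesis
    using ab(2) pow2_power pow2_add by metis
qed

text \<open>As \<open>(l, l')\<^sup>m\<close> is primary, this says that \<open>f\<close> vanishes to order \<open>m\<close> along the line \<open>l = l' = 0\<close>.\<close>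

definition vanishes :: "mpoly \<Rightarrow> mpoly \<Rightarrow> nat \<Rightarrow> mpoly \<Rightarrow> bool" where
  "vanishes l l' m f \<longleftrightarrow> (\<exists>s. s \<notin> ideal2 l l' \<and> s * f \<in> pow2 l l' m)"

text \<open>The multiplier \<open>s\<close> restricts to something not divisible by the prime
  \<open>subst \<rho> l'\<close>, so it can be cancelled modulo any power of that prime.\<close>

lemma vanishes_imp_dvd:
  assumes "linear_form l \<rho>" "prime_elem (subst \<rho> l')" "vanishes l l' m f"
  shows "subst \<rho> l' ^ m dvd subst \<rho> f"
proof -
  obtain s where s: "s \<notin> ideal2 l l'" "s * f \<in> pow2 l l' m"
    using assms(3) by (auto simp: vanishes_def)
  have "nzd_mod (subst \<rho> l' ^ m) (subst \<rho> s)"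
    using s(1) assms(2) by (intro nzd_mod_power_left nzd_mod_prime) (auto simp: ideal2_iff[OF assms(1)])
  then show ?thesis
    by (rule nzd_modD) (use subst_pow2[OF assms(1) s(2)] in \<open>simp add: mult.commute\<close>)
qed

lemma vanishes_cancel_notin:
  assumes "is_prime_ideal (ideal2 l l')" "k \<notin> ideal2 l l'" "vanishes l l' m (k * f)"
  shows "vanishes l l' m f"
  using assms unfolding vanishes_def is_prime_ideal_def by (metis mult.assoc)

lemma vanishes_cancel:
  assumes "linear_form l \<rho>" "\<not> l dvd l'" "vanishes l l' (Suc m) (l * f)"
  shows "vanishes l l' m f"
  using assms pow2_cancel unfolding vanishes_def by (metis mult.left_commute)

text \<open>Two families of equally many planes, meeting in a grid of lines. The point
  \<open>pt i j\<close> lies on \<open>l i\<close> and \<open>l' j\<close> and on no other plane of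
  either family; such points certify that the planes and lines are distinct.\<close>

locale line_grid =
  fixes I J :: "'i set" and l l' :: "'i \<Rightarrow> mpoly" and \<rho> :: "'i \<Rightarrow> var \<Rightarrow> mpoly"
    and pt :: "'i \<Rightarrow> 'i \<Rightarrow> var \<Rightarrow> complex"
  assumes finite: "finite I" "finite J" and card_eq: "card J = card I"
    and linear: "\<And>i. i \<in> I \<Longrightarrow> linear_form (l i) (\<rho> i)"
    and homog': "\<And>j. j \<in> J \<Longrightarrow> homog_of_deg 1 (l' j)"
    and prime': "\<And>i j. i \<in> I \<Longrightarrow> j \<in> J \<Longrightarrow> prime_elem (subst (\<rho> i) (l' j))"
    and pt_l: "\<And>i j i'. i \<in> I \<Longrightarrow> j \<in> J \<Longrightarrow> i' \<in> I \<Longrightarrow> eval_at (pt i j) (l i') = 0 \<longleftrightarrow> i' = i"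
    and pt_l': "\<And>i j j'. i \<in> I \<Longrightarrow> j \<in> J \<Longrightarrow> j' \<in> J \<Longrightarrow> eval_at (pt i j) (l' j') = 0 \<longleftrightarrow> j' = j"
begin

lemma prime_line: "i \<in> I \<Longrightarrow> j \<in> J \<Longrightarrow> is_prime_ideal (ideal2 (l i) (l' j))"
  using is_prime_ideal_ideal2 linear prime' by blast

text \<open>If the restriction of \<open>f\<close> to the plane were nonzero, it would be divisible
  by the \<open>m\<close>-th powers of \<open>card J\<close> linear forms, whose product has degree
  \<open>card I * m\<close>, exceeding \<open>d\<close>.\<close>

lemma dvd_of_vanishes:
  assumes i: "i \<in> I" and van: "\<And>j. j \<in> J \<Longrightarrow> vanishes (l i) (l' j) m f"
    and f: "homog_of_deg d f" "d < card I * m"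
  shows "l i dvd f"
proof (rule ccontr)
  assume "\<not> l i dvd f"
  then have nz: "subst (\<rho> i) f \<noteq> 0"
    using linear[OF i] by (simp add: linear_form_dvd_iff)
  have "(\<Prod>j\<in>J. subst (\<rho> i) (l' j) ^ m) dvd subst (\<rho> i) f"
  proof (rule prod_prime_powers_dvd)
    fix j assume "j \<in> J"
    then show "subst (\<rho> i) (l' j) ^ m dvd subst (\<rho> i) f"
      using vanishes_imp_dvd[OF linear[OF i] prime'[OF i] van] by blast
  next
    fix j j' assume j: "j \<in> J" "j' \<in> J" "j \<noteq> j'"
    \<comment> \<open>The point \<open>pt i j\<close> is on the plane \<open>l i = 0\<close>, so
      restriction does not change values there; among the forms of \<open>J\<close> only
      \<open>l' j\<close> vanishes at it.\<close>
    have ev: "eval_at (pt i j) (subst (\<rho> i) p) = eval_at (pt i j) p" for p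
      using eval_at_subst[OF linear[OF i]] pt_l[OF i j(1) i] by simp
    show "\<not> subst (\<rho> i) (l' j) dvd subst (\<rho> i) (l' j')"
      using eval_at_dvd[of _ _ "pt i j"] pt_l'[OF i j(1)] j ev by metis
  qed (use i finite prime' in auto)
  moreover have "homog_of_deg (\<Sum>j\<in>J. 1 * m) (\<Prod>j\<in>J. subst (\<rho> i) (l' j) ^ m)"
    using homog' linear[OF i]
    by (intro homog_prod homog_power homog_subst) (auto simp: linear_form_def)
  moreover have "homog_of_deg d (subst (\<rho> i) f)"
    using f linear[OF i] by (intro homog_subst) (auto simp: linear_form_def)
  ultimately have "(\<Sum>j\<in>J. 1 * m) \<le> d"
    using nz by (intro homog_dvd_le)
  then show False using f by (simp add: card_eq)
qed

lemma prod_l_dvd: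
  assumes "\<And>i. i \<in> I \<Longrightarrow> l i dvd f" "J \<noteq> {}"
  shows "(\<Prod>i\<in>I. l i) dvd f"
proof -
  \<comment> \<open>Any \<open>j\<close> serves: the points \<open>pt i j\<close> tell the planes of
    \<open>I\<close> apart.\<close>
  obtain j where j: "j \<in> J" using assms(2) by auto
  have "(\<Prod>i\<in>I. l i ^ 1) dvd f"
  proof (rule prod_prime_powers_dvd)
    fix i i' assume i: "i \<in> I" "i' \<in> I" "i \<noteq> i'"
    then show "\<not> l i dvd l i'"
      using eval_at_dvd[of _ _ "pt i j"] pt_l[OF i(1) j] by metis
  qed (use assms finite linear linear_form_prime in auto)
  then show ?thesis by simp
qed

lemma degree_bound:
  assumes "f \<noteq> 0" "homog_of_deg d f" "\<And>i j. i \<in> I \<Longrightarrow> j \<in> J \<Longrightarrow> vanishes (l i) (l' j) m f"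
  shows "card I * m \<le> d"
  using assms
proof (induction m arbitrary: f d)
  case (Suc m)
  show ?case
  proof (rule ccontr)
    assume "\<not> ?thesis"
    then have d: "d < card I * Suc m" by simp
    then have "card J \<noteq> 0" using card_eq by (metis mult_0 not_less_zero)
    then have "J \<noteq> {}" by auto
    then obtain g where g: "f = (\<Prod>i\<in>I. l i) * g"
      using prod_l_dvd[of f] dvd_of_vanishes[OF _ _ Suc.prems(2) d] Suc.prems(3) by (metis dvdE)
    have hl: "homog_of_deg (\<Sum>i\<in>I. 1) (\<Prod>i\<in>I. l i)"
      using linear by (intro homog_prod) (auto simp: linear_form_def)
    have "card I \<le> d" "homog_of_deg (d - card I) g"
      using homog_factor[OF _ hl, of d g] Suc.prems by (simp_all add: g)
    \<comment> \<open>Dividing by the product costs one order only: the factors other than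
      \<open>l i\<close> are nonzero at \<open>pt i j\<close>, hence outside the prime ideal and
      cancelled for free, while \<open>l i\<close> lowers the order by one.\<close>
    moreover have "vanishes (l i) (l' j) m g" if ij: "i \<in> I" "j \<in> J" for i j
    proof (rule vanishes_cancel)
      show "linear_form (l i) (\<rho> i)" using ij linear by simp
      show "\<not> l i dvd l' j"
        using linear_form_dvd_iff[OF linear[OF ij(1)]] prime'[OF ij] by auto
      let ?k = "\<Prod>i'\<in>I - {i}. l i'"
      have f: "f = ?k * (l i * g)"
        using ij finite by (simp add: g prod.remove[of I i] mult_ac)
      show "vanishes (l i) (l' j) (Suc m) (l i * g)"
      proof (rule vanishes_cancel_notin)
        have "eval_at (pt i j) ?k \<noteq> 0"
          using pt_l[OF ij] finite by auto
        then show "?k \<notin> ideal2 (l i) (l' j)"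
          using eval_at_ideal2[of "pt i j"] pt_l[OF ij ij(1)] pt_l'[OF ij ij(2)] by metis
      qed (use ij Suc.prems(3) prime_line f in auto)
    qed
    ultimately have "card I * m \<le> d - card I"
      using Suc.prems(1) by (intro Suc.IH[of g]) (auto simp: g)
    then show False using d \<open>card I \<le> d\<close> by simp
  qed
qed auto

text \<open>The annihilator of \<open>g\<close> modulo \<open>K\<close> contains both generators. It
  is no larger than the prime, as \<open>r * g\<close> lies in the prime and \<open>g\<close> does
  not.\<close>

lemma line_in_Ass:
  assumes ij: "i \<in> I" "j \<in> J" and K: "is_ideal K" "K \<subseteq> ideal2 (l i) (l' j)"
    and g: "g \<notin> ideal2 (l i) (l' j)" "l i * g \<in> K" "l' j * g \<in> K"
  shows "ideal2 (l i) (l' j) \<in> Ass K"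
proof -
  have "ideal2 (l i) (l' j) = {r. r * g \<in> K}"
  proof (intro equalityI subsetI)
    fix r assume "r \<in> ideal2 (l i) (l' j)"
    then obtain a b where "r = a * l i + b * l' j"
      by (auto simp: ideal2_def)
    then have "r * g = a * (l i * g) + b * (l' j * g)"
      by (simp add: algebra_simps)
    then show "r \<in> {r. r * g \<in> K}"
      using K g by (simp add: is_ideal_def)
  next
    fix r assume "r \<in> {r. r * g \<in> K}"
    then show "r \<in> ideal2 (l i) (l' j)"
      using K(2) g(1) prime_line[OF ij] by (auto simp: is_prime_ideal_def)
  qed
  then show ?thesis using prime_line[OF ij] by (auto simp: Ass_def)
qed

end

text \<open>The coefficient \<open>a\<close> is general because restricting \<open>X - d W\<close>
  to a plane \<open>X = c Y\<close> gives \<open>c Y - d W\<close>; the case \<open>b = 0\<close>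
  covers the variables themselves.\<close>

lemma linear_form_diff:
  assumes "a \<noteq> 0" "u \<noteq> v"
  shows "linear_form (Const a * Var v - Const b * Var u) ((Var)(v := Const (b / a) * Var u))"
proof -
  let ?l = "Const a * Var v - Const b * Var u"
  have "eval_at (\<lambda>w. if w = v then 1 else 0) ?l = a"
    using assms by simp
  then have nz: "?l \<noteq> 0" using assms eval_at_neq_0D by metis
  have hom: "homog_of_deg 1 (Const c * Var w)" for c w
    using homog_mult[OF homog_Const homog_Var] by simp
  have eq: "Var v - Const (b / a) * Var u = Const (1 / a) * ?l"
    using assms by (simp add: algebra_simps flip: mult.assoc Const_simps(4))
  have "?l dvd Var w - ((Var)(v := Const (b / a) * Var u)) w" for w
    using eq by (cases "w = v") auto
  then show ?thesis
    unfolding linear_form_def using assms nz hom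
    by (auto intro!: homog_diff simp del: One_nat_def simp flip: mult.assoc Const_simps(4))
qed

lemma linear_form_Var: "linear_form (Var v) ((Var)(v := 0))"
proof -
  obtain u where "u \<noteq> v" by (cases v) auto
  then show ?thesis using linear_form_diff[of 1 u v 0] by simp
qed

section \<open>Roots of unity and the linear factors of a difference of powers\<close>

definition unity_roots :: "nat \<Rightarrow> complex set" where
  "unity_roots n = {c. c ^ n = 1}"

lemma finite_unity_roots: "n > 0 \<Longrightarrow> finite (unity_roots n)"
  using card_roots_unity_eq[of n] by (metis card.infinite unity_roots_def not_gr0)

lemma card_unity_roots: "n > 0 \<Longrightarrow> card (unity_roots n) = n"
  by (simp add: unity_roots_def card_roots_unity_eq)

lemma unity_root_nonzero: "n > 0 \<Longrightarrow> c \<in> unity_roots n \<Longrightarrow> c \<noteq> 0"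
  by (auto simp: unity_roots_def power_0_left)

lemma norm_unity_root: "n > 0 \<Longrightarrow> c \<in> unity_roots n \<Longrightarrow> norm c = 1"
  by (auto simp: unity_roots_def dest!: power_eq_1_iff)

lemma linear_form_root:
  "u \<noteq> v \<Longrightarrow> linear_form (Var v - Const c * Var u) ((Var)(v := Const c * Var u))"
  using linear_form_diff[of 1 u v c] by simp

text \<open>The \<open>n\<close> linear factors are primes, none dividing another, and each divides
  the difference. Their product already has degree \<open>n\<close>, so the cofactor is homogeneous
  of degree 0, a constant.\<close>

lemma power_diff_factorization:
  assumes "u \<noteq> v" "n > 0"
  shows "\<exists>e. e \<noteq> 0 \<and> Var v ^ n - Var u ^ n = Const e * (\<Prod>c\<in>unity_roots n. Var v - Const c * Var u)"
proof -
  let ?l = "\<lambda>c. Var v - Const c * Var u" and ?f = "Var v ^ n - Var u ^ n"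
  have lf: "linear_form (?l c) ((Var)(v := Const c * Var u))" for c
    using linear_form_root[OF assms(1)] .
  have "(\<Prod>c\<in>unity_roots n. ?l c ^ 1) dvd ?f"
  proof (rule prod_prime_powers_dvd)
    fix c d assume "c \<in> unity_roots n" "d \<in> unity_roots n" "c \<noteq> d"
    then show "\<not> ?l c dvd ?l d"
      using assms linear_form_dvd_iff[OF lf[of c]] by (simp flip: left_diff_distrib Const_simps(5))
  next
    fix c assume "c \<in> unity_roots n"
    then show "?l c ^ 1 dvd ?f"
      using assms linear_form_dvd_iff[OF lf[of c]]
      by (simp add: power_mult_distrib unity_roots_def flip: Const_power)
  qed (use lf linear_form_prime finite_unity_roots assms in auto)
  then obtain g where g: "?f = (\<Prod>c\<in>unity_roots n. ?l c) * g"
    by (auto elim: dvdE)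
  have "eval_at (\<lambda>w. if w = v then 1 else 0) ?f \<noteq> 0"
    using assms by (simp add: power_0_left)
  then have nz: "?f \<noteq> 0" by (rule eval_at_neq_0D)
  have hf: "homog_of_deg (1 * n) ?f"
    by (intro homog_diff homog_power homog_Var)
  have "homog_of_deg (\<Sum>c\<in>unity_roots n. 1) (\<Prod>c\<in>unity_roots n. ?l c)"
    using lf by (intro homog_prod) (simp add: linear_form_def)
  then have "homog_of_deg 0 g"
    using homog_factor(2)[of "1 * n" _ g n] hf nz g assms by (simp add: card_unity_roots)
  then obtain e where "g = Const e" using homog_0_imp_Const by blast
  then show ?thesis
    using g nz by (intro exI[of _ e]) (auto simp: mult.commute)
qed

lemma nzd_mod_Const: "e \<noteq> 0 \<Longrightarrow> nzd_mod (Const e) b"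
proof -
  assume "e \<noteq> 0"
  then have "u = Const e * (Const (1 / e) * u)" for u
    by (simp flip: mult.assoc Const_simps(4))
  then have "Const e dvd u" for u by (metis dvd_triv_left)
  then show ?thesis by (simp add: nzd_mod_def)
qed

text \<open>Each linear factor is prime, and a point of its plane at which \<open>b\<close> is
  nonzero shows that it does not divide \<open>b\<close>.\<close>

lemma nzd_mod_power_diff:
  assumes "u \<noteq> v" "n > 0"
    and "\<And>c. c \<in> unity_roots n \<Longrightarrow> \<exists>pt. pt v = c * pt u \<and> eval_at pt b \<noteq> 0"
  shows "nzd_mod (Var v ^ n - Var u ^ n) b"
proof -
  obtain e where e: "e \<noteq> 0"
    "Var v ^ n - Var u ^ n = Const e * (\<Prod>c\<in>unity_roots n. Var v - Const c * Var u)"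
    using power_diff_factorization[OF assms(1,2)] by blast
  have "nzd_mod (\<Prod>c\<in>unity_roots n. Var v - Const c * Var u) b"
  proof (rule nzd_mod_prod_left)
    fix c assume "c \<in> unity_roots n"
    then obtain pt where pt: "pt v = c * pt u" "eval_at pt b \<noteq> 0" using assms(3) by blast
    have lf: "linear_form (Var v - Const c * Var u) ((Var)(v := Const c * Var u))"
      using linear_form_root[OF assms(1)] .
    have "\<not> Var v - Const c * Var u dvd b"
      using eval_at_dvd[of "Var v - Const c * Var u" b pt] pt by auto
    then show "nzd_mod (Var v - Const c * Var u) b \<and> Var v - Const c * Var u \<noteq> 0"
      using nzd_mod_prime linear_form_prime[OF lf] lf by (auto simp: linear_form_def)
  qed
  then show ?thesis
    unfolding e(2) using e(1) by (intro nzd_mod_mult_left nzd_mod_Const) auto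
qed

lemma nzd_mod_Var_power:
  assumes "pt v = 0" "eval_at pt b \<noteq> 0"
  shows "nzd_mod (Var v ^ n) b"
proof -
  have "\<not> Var v dvd b" using eval_at_dvd[of "Var v" b pt] assms by auto
  then show ?thesis
    by (intro nzd_mod_power_left nzd_mod_prime linear_form_prime[OF linear_form_Var]) auto
qed

subsection \<open>Localised powers of ideals\<close>

lemma is_idealD:
  assumes "is_ideal K"
  shows "0 \<in> K" "p \<in> K \<Longrightarrow> q \<in> K \<Longrightarrow> p + q \<in> K" "p \<in> K \<Longrightarrow> r * p \<in> K" "p \<in> K \<Longrightarrow> p * r \<in> K"
  using assms unfolding is_ideal_def by (blast, blast, blast, metis mult.commute)

lemma ideal_genI: "finite G \<Longrightarrow> G \<subseteq> S \<Longrightarrow> (\<Sum>g\<in>G. c g * g) \<in> ideal_gen S"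
  by (auto simp: ideal_gen_def)

lemma is_ideal_ideal_gen: "is_ideal (ideal_gen S)"
  unfolding is_ideal_def
proof (intro conjI allI ballI impI)
  show "0 \<in> ideal_gen S" by (auto simp: ideal_gen_def intro!: exI[of _ "{}"])
next
  fix p q assume "p \<in> ideal_gen S" "q \<in> ideal_gen S"
  then obtain G c H d where G: "finite G" "G \<subseteq> S" "p = (\<Sum>g\<in>G. c g * g)"
    and H: "finite H" "H \<subseteq> S" "q = (\<Sum>g\<in>H. d g * g)"
    by (auto simp: ideal_gen_def)
  have "p = (\<Sum>g\<in>G \<union> H. (if g \<in> G then c g else 0) * g)"
    unfolding G(3) using G(1) H(1) by (intro sum.mono_neutral_cong_left) auto
  moreover have "q = (\<Sum>g\<in>G \<union> H. (if g \<in> H then d g else 0) * g)"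
    unfolding H(3) using G(1) H(1) by (intro sum.mono_neutral_cong_left) auto
  ultimately have "p + q
      = (\<Sum>g\<in>G \<union> H. ((if g \<in> G then c g else 0) + (if g \<in> H then d g else 0)) * g)"
    by (simp add: distrib_right sum.distrib)
  then show "p + q \<in> ideal_gen S"
    using G H by (simp only:) (intro ideal_genI, auto)
next
  fix r p assume "p \<in> ideal_gen S"
  then obtain G c where G: "finite G" "G \<subseteq> S" "p = (\<Sum>g\<in>G. c g * g)"
    by (auto simp: ideal_gen_def)
  then have "r * p = (\<Sum>g\<in>G. (r * c g) * g)" by (simp add: sum_distrib_left mult.assoc)
  then show "r * p \<in> ideal_gen S" using G by (simp only:) (intro ideal_genI, auto)
qed

lemma ideal_gen_superset: "S \<subseteq> ideal_gen S"
proof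
  fix s assume "s \<in> S"
  then show "s \<in> ideal_gen S"
    unfolding ideal_gen_def by (auto intro!: exI[of _ "{s}"] exI[of _ "\<lambda>_. 1"])
qed

lemma ideal_gen_least:
  assumes "is_ideal K" "S \<subseteq> K"
  shows "ideal_gen S \<subseteq> K"
proof
  fix p assume "p \<in> ideal_gen S"
  then obtain G c where G: "finite G" "G \<subseteq> S" and p: "p = (\<Sum>g\<in>G. c g * g)"
    by (auto simp: ideal_gen_def)
  from G have "(\<Sum>g\<in>G. c g * g) \<in> K"
    by induction (use assms in \<open>auto intro: is_idealD(1,2) is_idealD(3)\<close>)
  then show "p \<in> K" by (simp add: p)
qed

lemma is_ideal_ideal_power: "is_ideal (ideal_power I m)"
  unfolding ideal_power_def by (rule is_ideal_ideal_gen)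

lemma prod_list_in_ideal_power: "set xs \<subseteq> I \<Longrightarrow> prod_list xs \<in> ideal_power I (length xs)"
  unfolding ideal_power_def by (rule subsetD[OF ideal_gen_superset]) auto

lemma ideal_power_least:
  assumes "is_ideal K" "\<And>xs. length xs = m \<Longrightarrow> set xs \<subseteq> I \<Longrightarrow> prod_list xs \<in> K"
  shows "ideal_power I m \<subseteq> K"
  unfolding ideal_power_def using assms by (intro ideal_gen_least) auto

text \<open>Bilinearity in two rounds: for a fixed product of \<open>k\<close> elements, the
  admissible \<open>q\<close> form an ideal containing all products of \<open>m\<close> elements;
  then the same argument is applied to \<open>p\<close>.\<close>

lemma ideal_power_mult:
  assumes "p \<in> ideal_power I k" "q \<in> ideal_power I m"
  shows "p * q \<in> ideal_power I (k + m)"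
proof -
  let ?T = "ideal_power I (k + m)"
  note T = is_idealD[OF is_ideal_ideal_power]
  have "ideal_power I m \<subseteq> {q. prod_list xs * q \<in> ?T}" if "length xs = k" "set xs \<subseteq> I" for xs
  proof (rule ideal_power_least)
    show "is_ideal {q. prod_list xs * q \<in> ?T}"
      using T unfolding is_ideal_def by (auto simp: distrib_left mult.left_commute)
    show "prod_list ys \<in> {q. prod_list xs * q \<in> ?T}" if "length ys = m" "set ys \<subseteq> I" for ys
      using prod_list_in_ideal_power[of "xs @ ys" I] that \<open>length xs = k\<close> \<open>set xs \<subseteq> I\<close> by simp
  qed
  moreover have "is_ideal {p. p * q \<in> ?T}"
    using T unfolding is_ideal_def by (auto simp: distrib_right mult.assoc)
  ultimately have "ideal_power I k \<subseteq> {p. p * q \<in> ?T}"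
    using assms(2) by (intro ideal_power_least) auto
  then show ?thesis using assms(1) by auto
qed

lemma ideal_power_0: "ideal_power I 0 = UNIV"
proof -
  have "1 \<in> ideal_power I 0" using prod_list_in_ideal_power[of "[]" I] by simp
  then have "r * 1 \<in> ideal_power I 0" for r using is_idealD(3)[OF is_ideal_ideal_power] by blast
  then show ?thesis by auto
qed

lemma ideal_power_1: "I \<subseteq> ideal_power I 1"
proof
  fix p assume "p \<in> I"
  then show "p \<in> ideal_power I 1" using prod_list_in_ideal_power[of "[p]" I] by simp
qed

lemma ideal_power_antimono: "k \<le> m \<Longrightarrow> ideal_power I m \<subseteq> ideal_power I k"
proof (induction m rule: dec_induct)
  case (step m)
  have "ideal_power I (Suc m) \<subseteq> ideal_power I m"
  proof (rule ideal_power_least[OF is_ideal_ideal_power])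
    fix xs assume "length xs = Suc m" "set xs \<subseteq> I"
    then obtain y ys where "xs = y # ys" "length ys = m" "set ys \<subseteq> I" by (cases xs) auto
    then show "prod_list xs \<in> ideal_power I m"
      using prod_list_in_ideal_power[of ys I] is_idealD(3)[OF is_ideal_ideal_power] by auto
  qed
  then show ?case using step by blast
qed auto

text \<open>Membership in the contraction of \<open>I\<^sup>m R\<^sub>P\<close>.\<close>

definition locally_in_power :: "'a::comm_ring_1 set \<Rightarrow> 'a set \<Rightarrow> nat \<Rightarrow> 'a \<Rightarrow> bool" where
  "locally_in_power I P m f \<longleftrightarrow> (\<exists>s. s \<notin> P \<and> s * f \<in> ideal_power I m)"

lemma prime_ideal_mult_notin: "is_prime_ideal P \<Longrightarrow> s \<notin> P \<Longrightarrow> t \<notin> P \<Longrightarrow> s * t \<notin> P"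
  by (auto simp: is_prime_ideal_def)

lemma locally_in_power_mult:
  assumes P: "is_prime_ideal P" and "locally_in_power I P k f" "locally_in_power I P m g"
  shows "locally_in_power I P (k + m) (f * g)"
proof -
  obtain s t where st: "s \<notin> P" "s * f \<in> ideal_power I k" "t \<notin> P" "t * g \<in> ideal_power I m"
    using assms(2,3) by (auto simp: locally_in_power_def)
  then have "(s * t) * (f * g) \<in> ideal_power I (k + m)"
    using ideal_power_mult[OF st(2,4)] by (simp add: mult_ac)
  then show ?thesis
    unfolding locally_in_power_def using prime_ideal_mult_notin[OF P st(1,3)] by blast
qed

lemma locally_in_power_diff:
  assumes P: "is_prime_ideal P" and "locally_in_power I P m f" "locally_in_power I P m g"
  shows "locally_in_power I P m (f - g)"
proof -
  note T = is_idealD[OF is_ideal_ideal_power]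
  obtain s t where st: "s \<notin> P" "s * f \<in> ideal_power I m" "t \<notin> P" "t * g \<in> ideal_power I m"
    using assms(2,3) by (auto simp: locally_in_power_def)
  have "(s * t) * (f - g) = t * (s * f) + (- s) * (t * g)"
    by (simp add: algebra_simps)
  then have "(s * t) * (f - g) \<in> ideal_power I m"
    using T(2)[OF T(3)[OF st(2), of t] T(3)[OF st(4), of "- s"]] by metis
  then show ?thesis
    unfolding locally_in_power_def using prime_ideal_mult_notin[OF P st(1,3)] by blast
qed

lemma locally_in_power_0: "is_prime_ideal P \<Longrightarrow> locally_in_power I P 0 f"
  unfolding locally_in_power_def is_prime_ideal_def ideal_power_0 by blast

lemma locally_in_power_power:
  assumes P: "is_prime_ideal P" and "locally_in_power I P k f"
  shows "locally_in_power I P (k * j) (f ^ j)"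
proof (induction j)
  case (Suc j)
  then show ?case using locally_in_power_mult[OF assms Suc] by simp
qed (simp add: locally_in_power_0 P)

lemma locally_in_power_mono: "locally_in_power I P m f \<Longrightarrow> k \<le> m \<Longrightarrow> locally_in_power I P k f"
  unfolding locally_in_power_def using ideal_power_antimono by blast

lemma locally_in_powerI: "s \<notin> P \<Longrightarrow> s * f \<in> I \<Longrightarrow> locally_in_power I P 1 f"
  unfolding locally_in_power_def using ideal_power_1 by blast

subsection \<open>Saturation of the ideal\<close>

definition FA :: "nat \<Rightarrow> mpoly" where
  "FA n = (Var X ^ n - Var Y ^ n) * (Var Z ^ n - Var W ^ n)"

definition FB :: "nat \<Rightarrow> mpoly" where
  "FB n = (Var X ^ n - Var Z ^ n) * (Var Y ^ n - Var W ^ n)"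

definition FC :: "nat \<Rightarrow> mpoly" where
  "FC n = (Var X ^ n - Var W ^ n) * (Var Y ^ n - Var Z ^ n)"

lemma FB_eq: "FB n = FA n + FC n"
  by (simp add: FA_def FB_def FC_def algebra_simps)

lemma I_n_eq: "I_n n = ideal_gen {FA n * Var X * Var Y, FA n * Var Z * Var W,
    FB n * Var X * Var Z, FB n * Var Y * Var W, FC n * Var X * Var W, FC n * Var Y * Var Z}"
  by (simp add: I_n_def Let_def FA_def FB_def FC_def)

lemma is_ideal_I_n: "is_ideal (I_n n)"
  unfolding I_n_eq by (rule is_ideal_ideal_gen)

lemma I_n_generators:
  "FA n * Var X * Var Y \<in> I_n n" "FA n * Var Z * Var W \<in> I_n n"
  "FB n * Var X * Var Z \<in> I_n n" "FB n * Var Y * Var W \<in> I_n n"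
  "FC n * Var X * Var W \<in> I_n n" "FC n * Var Y * Var Z \<in> I_n n"
  using ideal_gen_superset[of "{FA n * Var X * Var Y, FA n * Var Z * Var W,
    FB n * Var X * Var Z, FB n * Var Y * Var W, FC n * Var X * Var W, FC n * Var Y * Var Z}"]
  unfolding I_n_eq by auto

lemma I_n_subset:
  assumes "is_ideal K" "FA n \<in> K" "FC n \<in> K"
  shows "I_n n \<subseteq> K"
proof -
  have "FB n \<in> K" unfolding FB_eq using assms is_idealD(2) by blast
  then show ?thesis
    unfolding I_n_eq using assms by (intro ideal_gen_least) (auto intro!: is_idealD(4)[OF assms(1)])
qed

text \<open>The intersection of the ideals of the six coordinate lines.\<close>

definition proj :: "var set \<Rightarrow> mpoly \<Rightarrow> mpoly" where
  "proj S = subst (\<lambda>v. if v \<in> S then Var v else 0)"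

lemma proj_simps [simp]:
  "proj S 0 = 0" "proj S 1 = 1" "proj S (p + q) = proj S p + proj S q"
  "proj S (p - q) = proj S p - proj S q" "proj S (p * q) = proj S p * proj S q"
  "proj S (p ^ k) = proj S p ^ k" "proj S (Var v) = (if v \<in> S then Var v else 0)"
  by (simp_all add: proj_def)

text \<open>Turns equations between restrictions to coordinate subspaces into conditions on
  individual coefficients.\<close>

lemma lookup_proj:
  "Poly_Mapping.lookup (proj S p) a = (if Poly_Mapping.keys a \<subseteq> S then Poly_Mapping.lookup p a else 0)"
proof (induction p rule: mpoly_additive_induct)
  case (single b c)
  have "proj S (Poly_Mapping.single b c) = (if Poly_Mapping.keys b \<subseteq> S then Poly_Mapping.single b c else 0)"
  proof (cases "Poly_Mapping.keys b \<subseteq> S")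
    case True
    then have "v \<notin> S \<Longrightarrow> Poly_Mapping.lookup b v = 0" for v
      by (meson in_keys_iff subsetD)
    then have "(if v \<in> S then Var v else 0) ^ Poly_Mapping.lookup b v = Var v ^ Poly_Mapping.lookup b v" for v
      by auto
    then show ?thesis using True by (simp add: proj_def subst_single single_eq_prod)
  next
    case False
    then obtain v where "v \<in> Poly_Mapping.keys b" "v \<notin> S" by blast
    then have "\<exists>v\<in>UNIV. (if v \<in> S then Var v else 0) ^ Poly_Mapping.lookup b v = 0"
      by (intro bexI[of _ v]) (auto simp: in_keys_iff power_0_left)
    then have "(\<Prod>v\<in>UNIV. (if v \<in> S then Var v else 0) ^ Poly_Mapping.lookup b v) = 0"
      by (simp add: prod_zero_iff)
    then show ?thesis using False by (simp add: proj_def subst_single)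
  qed
  then show ?case by (auto simp: lookup_single when_def)
qed (auto simp: lookup_add)

definition coordinate_lines :: "mpoly set" where
  "coordinate_lines = {p. \<forall>S. card S = 2 \<longrightarrow> proj S p = 0}"

lemma is_ideal_coordinate_lines: "is_ideal coordinate_lines"
  by (auto simp: is_ideal_def coordinate_lines_def)

lemma card_2_vars:
  fixes S :: "var set"
  assumes "card S = 2"
  shows "S \<in> {{X, Y}, {X, Z}, {X, W}, {Y, Z}, {Y, W}, {Z, W}}"
proof -
  obtain u v where "S = {u, v}" "u \<noteq> v" using assms by (auto simp: card_2_iff)
  then show ?thesis by (cases u; cases v) auto
qed

lemma I_n_subset_coordinate_lines:
  assumes "n > 0"
  shows "I_n n \<subseteq> coordinate_lines"
  unfolding I_n_eq
proof (rule ideal_gen_least[OF is_ideal_coordinate_lines])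
  show "{FA n * Var X * Var Y, FA n * Var Z * Var W, FB n * Var X * Var Z,
     FB n * Var Y * Var W, FC n * Var X * Var W, FC n * Var Y * Var Z} \<subseteq> coordinate_lines"
    unfolding coordinate_lines_def using assms
    by (auto dest!: card_2_vars simp: FA_def FB_def FC_def power_0_left)
qed

text \<open>A two-element set meets any three of the four variables, so on each line one of the
  three survives and can be cancelled.\<close>

lemma coordinate_lines_cancel:
  assumes "u \<noteq> v" "v \<noteq> w" "u \<noteq> w"
    and "Var u * g \<in> coordinate_lines" "Var v * g \<in> coordinate_lines" "Var w * g \<in> coordinate_lines"
  shows "g \<in> coordinate_lines"
  unfolding coordinate_lines_def
proof (intro CollectI allI impI)
  fix S :: "var set" assume S: "card S = 2"
  have "u \<in> S \<or> v \<in> S \<or> w \<in> S"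
    using card_2_vars[OF S] assms(1-3) by (cases u; cases v; cases w) auto
  moreover have "proj S (Var u * g) = 0" "proj S (Var v * g) = 0" "proj S (Var w * g) = 0"
    using assms(4-6) S by (auto simp: coordinate_lines_def)
  ultimately show "proj S g = 0" by auto
qed

lemma ideal2_of_keys:
  assumes "v \<noteq> u" "v' \<noteq> u'"
    and "\<And>a. a \<in> Poly_Mapping.keys p \<Longrightarrow> {v, u} \<subseteq> Poly_Mapping.keys a \<or> {v', u'} \<subseteq> Poly_Mapping.keys a"
  shows "p \<in> ideal2 (Var v * Var u) (Var v' * Var u')"
proof -
  let ?K = "ideal2 (Var v * Var u) (Var v' * Var u')"
  note K = is_idealD[OF is_ideal_ideal2]
  have dvd: "Var x * Var y dvd Poly_Mapping.single a c"
    if "x \<noteq> y" "{x, y} \<subseteq> Poly_Mapping.keys a" for x y a c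
  proof -
    have "Var z dvd Var z ^ Poly_Mapping.lookup a z" if "z \<in> Poly_Mapping.keys a" for z
      using that by (intro dvd_power) (auto simp: in_keys_iff)
    then have "Var x * Var y dvd Var x ^ Poly_Mapping.lookup a x * Var y ^ Poly_Mapping.lookup a y"
      using that by (intro mult_dvd_mono) auto
    also have "\<dots> = (\<Prod>z\<in>{x, y}. Var z ^ Poly_Mapping.lookup a z)"
      using that by simp
    also have "\<dots> dvd (\<Prod>z\<in>UNIV. Var z ^ Poly_Mapping.lookup a z)"
      by (rule prod_dvd_prod_subset) auto
    finally show ?thesis by (simp add: single_eq_prod)
  qed
  have single: "Poly_Mapping.single a c \<in> ?K" if "a \<in> Poly_Mapping.keys p" for a c
    using assms(3)[OF that]
  proof
    assume "{v, u} \<subseteq> Poly_Mapping.keys a"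
    then obtain k where "Poly_Mapping.single a c = Var v * Var u * k"
      using dvd[OF assms(1)] by (metis dvdE)
    then show ?thesis using ideal2I[of k "Var v * Var u" 0] by (simp add: mult.commute)
  next
    assume "{v', u'} \<subseteq> Poly_Mapping.keys a"
    then obtain k where "Poly_Mapping.single a c = Var v' * Var u' * k"
      using dvd[OF assms(2)] by (metis dvdE)
    then show ?thesis using ideal2I[of 0 _ k "Var v' * Var u'"] by (simp add: mult.commute)
  qed
  have "(\<Sum>a\<in>S. Poly_Mapping.single a (Poly_Mapping.lookup p a)) \<in> ?K"
    if "S \<subseteq> Poly_Mapping.keys p" for S
    using that by (induction S rule: infinite_finite_induct) (auto intro: K(1,2) single)
  from this[OF subset_refl] show ?thesis by (simp flip: mpoly_eq_sum_single)
qed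

definition restrict_keys :: "((var \<Rightarrow>\<^sub>0 nat) \<Rightarrow> bool) \<Rightarrow> mpoly \<Rightarrow> mpoly" where
  "restrict_keys Q p = (\<Sum>a\<in>{a \<in> Poly_Mapping.keys p. Q a}. Poly_Mapping.single a (Poly_Mapping.lookup p a))"

lemma lookup_restrict_keys:
  "Poly_Mapping.lookup (restrict_keys Q p) a = (if Q a then Poly_Mapping.lookup p a else 0)"
  by (auto simp: restrict_keys_def lookup_sum lookup_single when_def in_keys_iff)

text \<open>Restriction to the six lines limits which monomials occur in the coefficients
  \<open>\<alpha>\<close> and \<open>\<gamma>\<close>. Moving their common part to
  \<open>FB n\<close> leaves only monomials divisible by those of the generators.\<close>

lemma complete_intersection_Int_coordinate_lines:
  assumes "n > 0" "f = \<alpha> * FA n + \<gamma> * FC n" "f \<in> coordinate_lines"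
  shows "f \<in> I_n n"
proof -
  have pf: "proj S \<alpha> * proj S (FA n) + proj S \<gamma> * proj S (FC n) = 0" if "card S = 2" for S
    using assms(2,3) that by (simp add: coordinate_lines_def)
  note [simp] = FA_def FC_def power_0_left
  let ?L = "Poly_Mapping.lookup" and ?k = "Poly_Mapping.keys :: (var \<Rightarrow>\<^sub>0 nat) \<Rightarrow> _"
  \<comment> \<open>On \<open>{X, Z}\<close> and \<open>{Y, W}\<close> the restrictions of
    \<open>FA n\<close> and \<open>FC n\<close> are nonzero and opposite; on \<open>{X, Y}\<close>
    and \<open>{Z, W}\<close> only \<open>FC n\<close> survives, on \<open>{X, W}\<close> and
    \<open>{Y, Z}\<close> only \<open>FA n\<close>.\<close>
  have "proj {X, Z} \<alpha> = proj {X, Z} \<gamma>" "proj {Y, W} \<alpha> = proj {Y, W} \<gamma>"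
    "proj {X, Y} \<gamma> = 0" "proj {Z, W} \<gamma> = 0" "proj {X, W} \<alpha> = 0" "proj {Y, Z} \<alpha> = 0"
    using pf[of "{X, Z}"] pf[of "{Y, W}"] pf[of "{X, Y}"] pf[of "{Z, W}"] pf[of "{X, W}"] pf[of "{Y, Z}"]
      assms(1) by auto
  then have "?k a \<subseteq> {X, Z} \<Longrightarrow> ?L \<alpha> a = ?L \<gamma> a" "?k a \<subseteq> {Y, W} \<Longrightarrow> ?L \<alpha> a = ?L \<gamma> a"
    "?k a \<subseteq> {X, Y} \<Longrightarrow> ?L \<gamma> a = 0" "?k a \<subseteq> {Z, W} \<Longrightarrow> ?L \<gamma> a = 0"
    "?k a \<subseteq> {X, W} \<Longrightarrow> ?L \<alpha> a = 0" "?k a \<subseteq> {Y, Z} \<Longrightarrow> ?L \<alpha> a = 0" for a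
    by (metis lookup_proj lookup_zero)+
  note L = this
  have sub: "S \<subseteq> T \<longleftrightarrow> (X \<in> S \<longrightarrow> X \<in> T) \<and> (Y \<in> S \<longrightarrow> Y \<in> T) \<and> (Z \<in> S \<longrightarrow> Z \<in> T) \<and> (W \<in> S \<longrightarrow> W \<in> T)" for S T
  proof -
    have "S \<subseteq> T \<longleftrightarrow> (\<forall>v\<in>UNIV. v \<in> S \<longrightarrow> v \<in> T)" by auto
    then show ?thesis unfolding UNIV_var by simp
  qed
  \<comment> \<open>On the monomials selected by \<open>Q\<close> the two coefficients agree, so
    \<open>p\<close> is a part of both and may be attached to
    \<open>FA n + FC n = FB n\<close>.\<close>
  define Q where "Q a \<longleftrightarrow> ?k a \<subseteq> {X, Z} \<or> ?k a \<subseteq> {Y, W}" for a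
  define p where "p = restrict_keys Q \<alpha>"
  have Lp: "?L p a = (if Q a then ?L \<alpha> a else 0)" for a
    by (simp add: p_def lookup_restrict_keys)
  have "\<alpha> - p \<in> ideal2 (Var X * Var Y) (Var Z * Var W)"
  proof (rule ideal2_of_keys)
    fix a assume "a \<in> Poly_Mapping.keys (\<alpha> - p)"
    then have "\<not> Q a" "?L \<alpha> a \<noteq> 0" by (auto simp: in_keys_iff lookup_minus Lp split: if_splits)
    then show "{X, Y} \<subseteq> ?k a \<or> {Z, W} \<subseteq> ?k a"
      using L(5,6)[of a] unfolding Q_def sub by auto
  qed auto
  moreover have "\<gamma> - p \<in> ideal2 (Var X * Var W) (Var Y * Var Z)"
  proof (rule ideal2_of_keys)
    fix a assume "a \<in> Poly_Mapping.keys (\<gamma> - p)"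
    then have "\<not> Q a" "?L \<gamma> a \<noteq> 0"
      using L(1,2)[of a] by (auto simp: in_keys_iff lookup_minus Lp Q_def split: if_splits)
    then show "{X, W} \<subseteq> ?k a \<or> {Y, Z} \<subseteq> ?k a"
      using L(3,4)[of a] unfolding Q_def sub by auto
  qed auto
  moreover have "p \<in> ideal2 (Var X * Var Z) (Var Y * Var W)"
  proof (rule ideal2_of_keys)
    fix a assume "a \<in> Poly_Mapping.keys p"
    then have "Q a" "?L \<alpha> a \<noteq> 0" by (auto simp: in_keys_iff Lp split: if_splits)
    then show "{X, Z} \<subseteq> ?k a \<or> {Y, W} \<subseteq> ?k a"
      using L(5,6)[of a] unfolding Q_def sub by auto
  qed auto
  ultimately obtain a b c d e g where
    "\<alpha> - p = a * (Var X * Var Y) + b * (Var Z * Var W)"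
    "\<gamma> - p = c * (Var X * Var W) + d * (Var Y * Var Z)"
    "p = e * (Var X * Var Z) + g * (Var Y * Var W)"
    unfolding ideal2_def by blast
  note decomp = this
  have "f = (\<alpha> - p) * FA n + (\<gamma> - p) * FC n + p * FB n"
    unfolding assms(2) FB_eq by (simp add: algebra_simps del: FA_def FC_def)
  also have "\<dots> = a * (FA n * Var X * Var Y) + b * (FA n * Var Z * Var W)
      + (c * (FC n * Var X * Var W) + d * (FC n * Var Y * Var Z))
      + (e * (FB n * Var X * Var Z) + g * (FB n * Var Y * Var W))"
    unfolding decomp(1,2) by (subst decomp(3)) (simp add: algebra_simps del: FA_def FC_def)
  also have "\<dots> \<in> I_n n"
    by (intro is_idealD(2,3)[OF is_ideal_I_n] I_n_generators)
  finally show ?thesis .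
qed

text \<open>Modulo \<open>v\<close>, the relation between \<open>a\<close> and \<open>c\<close> is a
  multiple \<open>t\<close> of the Koszul relation. Subtracting a lift of that multiple makes both
  coefficients divisible by \<open>v\<close>, which then cancels.\<close>

lemma complete_intersection_cancel:
  assumes lf: "linear_form v \<rho>" and nz: "subst \<rho> a \<noteq> 0" and nzd: "nzd_mod (subst \<rho> a) (subst \<rho> c)"
    and g: "v * g \<in> ideal2 a c"
  shows "g \<in> ideal2 a c"
proof -
  obtain \<alpha> \<gamma> where eq: "v * g = \<alpha> * a + \<gamma> * c" using g by (auto simp: ideal2_def)
  let ?\<phi> = "subst \<rho>"
  have "?\<phi> (v * g) = 0" using lf by (simp add: linear_form_def)
  then have 0: "?\<phi> \<alpha> * ?\<phi> a + ?\<phi> \<gamma> * ?\<phi> c = 0" unfolding eq by simp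
  then have "?\<phi> \<gamma> * ?\<phi> c = ?\<phi> a * (- ?\<phi> \<alpha>)" by (simp add: algebra_simps add_eq_0_iff)
  then have "?\<phi> a dvd ?\<phi> \<gamma> * ?\<phi> c" by (metis dvd_triv_left)
  then obtain t where t: "?\<phi> \<gamma> = ?\<phi> a * t" using nzd_modD[OF nzd] by (metis dvdE)
  have "?\<phi> a * (?\<phi> \<alpha> + t * ?\<phi> c) = 0" using 0 by (simp add: t algebra_simps)
  then have t': "?\<phi> \<alpha> = - (t * ?\<phi> c)" using nz by (simp add: eq_neg_iff_add_eq_0)
  have cong: "v dvd q - ?\<phi> q" for q
    using lf by (intro subst_congruence_dvd) (simp add: linear_form_def)
  have "\<gamma> - t * a = (\<gamma> - ?\<phi> \<gamma>) - t * (a - ?\<phi> a)" by (simp add: t algebra_simps)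
  then have "v dvd \<gamma> - t * a" using cong by (metis dvd_diff dvd_mult)
  moreover have "\<alpha> + t * c = (\<alpha> - ?\<phi> \<alpha>) + t * (c - ?\<phi> c)" by (simp add: t' algebra_simps)
  then have "v dvd \<alpha> + t * c" using cong by (metis dvd_add dvd_mult)
  ultimately obtain \<alpha>' \<gamma>' where "\<gamma> - t * a = v * \<gamma>'" "\<alpha> + t * c = v * \<alpha>'"
    by (elim dvdE)
  moreover have "v * g = (\<alpha> + t * c) * a + (\<gamma> - t * a) * c"
    unfolding eq by (simp add: algebra_simps)
  ultimately have "v * g = v * (\<alpha>' * a + \<gamma>' * c)" by (simp add: algebra_simps)
  then have "g = \<alpha>' * a + \<gamma>' * c" using lf by (simp add: linear_form_def)
  then show ?thesis using ideal2I by simp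
qed

text \<open>\<open>X\<close> and \<open>Y\<close> suffice, because three distinct variables always
  include one of them.\<close>

lemma complete_intersection_cancel_Var:
  assumes n: "n > 0" and "v \<in> {X, Y}" "Var v * g \<in> ideal2 (FA n) (FC n)"
  shows "g \<in> ideal2 (FA n) (FC n)"
proof -
  \<comment> \<open>Later the value 2 for \<open>X\<close> and \<open>Y\<close> keeps the restricted
    \<open>FC n\<close> nonzero where \<open>Z\<close> and \<open>W\<close> are roots of
    unity.\<close>
  have two: "(2::complex) ^ n \<noteq> 1"
    using n by (metis norm_numeral norm_one norm_power one_less_numeral_iff one_less_power
        less_irrefl semiring_norm(76))
  let ?\<phi> = "subst ((Var)(v := 0))"
  define u where "u = (if v = X then Y else X)"
  have A: "?\<phi> (FA n) = Const (if v = X then - 1 else 1) * Var u ^ n * (Var Z ^ n - Var W ^ n)"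
    using assms n by (auto simp: FA_def power_0_left u_def)
  have C: "?\<phi> (FC n) = (if v = X then - (Var W ^ n) * (Var Y ^ n - Var Z ^ n) else (Var X ^ n - Var W ^ n) * - (Var Z ^ n))"
    using assms n by (auto simp: FC_def power_0_left u_def)
  have u: "u = X \<and> v = Y \<or> u = Y \<and> v = X" using assms(2) by (auto simp: u_def)
  have nzZW: "Var Z ^ n - Var W ^ n \<noteq> 0"
    by (rule eval_at_neq_0D[of "\<lambda>w. if w = Z then 1 else 0"]) (use n in \<open>simp add: power_0_left\<close>)
  show ?thesis
  proof (rule complete_intersection_cancel[OF linear_form_Var])
    show "?\<phi> (FA n) \<noteq> 0" unfolding A using nzZW by auto
    have "nzd_mod (Var u ^ n) (?\<phi> (FC n))"
      by (rule nzd_mod_Var_power[of "\<lambda>w. if w = u then 0 else 1"]) (use u n in \<open>auto simp: C power_0_left\<close>)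
    moreover have "nzd_mod (Var Z ^ n - Var W ^ n) (?\<phi> (FC n))"
    proof (rule nzd_mod_power_diff)
      fix c assume "c \<in> unity_roots n"
      then have c: "c ^ n = 1" "c \<noteq> 0" using unity_root_nonzero n by (auto simp: unity_roots_def)
      show "\<exists>pt. pt Z = c * pt W \<and> eval_at pt (?\<phi> (FC n)) \<noteq> 0"
        using u c two by (intro exI[of _ "\<lambda>w. case w of X \<Rightarrow> 2 | Y \<Rightarrow> 2 | Z \<Rightarrow> c | W \<Rightarrow> 1"]) (auto simp: C)
    qed (use n in auto)
    ultimately show "nzd_mod (?\<phi> (FA n)) (?\<phi> (FC n))"
      unfolding A by (intro nzd_mod_mult_left nzd_mod_Const) auto
  qed (use assms in auto)
qed

lemma I_n_cancel:
  assumes n: "n > 0" and "u \<noteq> v" "v \<noteq> w" "u \<noteq> w"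
    and "Var u * g \<in> I_n n" "Var v * g \<in> I_n n" "Var w * g \<in> I_n n"
  shows "g \<in> I_n n"
proof -
  have sub: "I_n n \<subseteq> ideal2 (FA n) (FC n)"
    using ideal2I[of 1 "FA n" 0 "FC n"] ideal2I[of 0 "FA n" 1 "FC n"]
    by (intro I_n_subset is_ideal_ideal2) auto
  have "u \<in> {X, Y} \<or> v \<in> {X, Y} \<or> w \<in> {X, Y}"
    using assms(2-4) by (cases u; cases v; cases w) auto
  then have "g \<in> ideal2 (FA n) (FC n)"
    using complete_intersection_cancel_Var[OF n] sub assms(5-7) by blast
  moreover have "g \<in> coordinate_lines"
    using coordinate_lines_cancel[OF assms(2-4)] I_n_subset_coordinate_lines[OF n] assms(5-7) by blast
  ultimately show ?thesis
    using complete_intersection_Int_coordinate_lines[OF n] by (auto simp: ideal2_def)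
qed

text \<open>\<open>P\<close> is the annihilator of some \<open>g\<close> modulo the ideal. Three
  variables in \<open>P\<close> would force \<open>g\<close> into the ideal, hence 1 into
  \<open>P\<close>.\<close>

lemma Ass_vars:
  assumes n: "n > 0" and P: "P \<in> Ass (I_n n)" and uvw: "u \<noteq> v" "v \<noteq> w" "u \<noteq> w"
    and "Var u \<in> P" "Var v \<in> P" "Var w \<in> P"
  shows False
proof -
  obtain g where P': "is_prime_ideal P" "P = {r. r * g \<in> I_n n}" using P by (auto simp: Ass_def)
  then have "g \<in> I_n n" using I_n_cancel[OF n uvw] assms(6-8) by auto
  then have "1 \<in> P" using P' by simp
  then show False using P' by (simp add: is_prime_ideal_def)
qed

subsection \<open>The product \<open>A\<^sup>a B\<^sup>b C\<^sup>c\<close> in the symbolic power\<close>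

lemma prime_ideal_power_iff:
  assumes "is_prime_ideal P" "n > 0"
  shows "p ^ n \<in> P \<longleftrightarrow> p \<in> P"
proof
  show "p ^ n \<in> P \<Longrightarrow> p \<in> P"
    by (induction n) (use assms in \<open>auto simp: is_prime_ideal_def\<close>)
  show "p \<in> P \<Longrightarrow> p ^ n \<in> P"
    using assms by (cases n) (auto simp: is_prime_ideal_def intro: is_idealD(4))
qed

lemma power_diff_notin:
  assumes P: "is_prime_ideal P" and "n > 0" and pq: "(p \<in> P) \<noteq> (q \<in> P)"
  shows "p ^ n - q ^ n \<notin> P"
proof
  assume *: "p ^ n - q ^ n \<in> P"
  have I: "is_ideal P" using P by (simp add: is_prime_ideal_def)
  have "p ^ n \<in> P \<longleftrightarrow> q ^ n \<in> P"
  proof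
    assume "p ^ n \<in> P"
    then have "p ^ n + (- 1) * (p ^ n - q ^ n) \<in> P" using * is_idealD(2,3)[OF I] by blast
    then show "q ^ n \<in> P" by simp
  next
    assume "q ^ n \<in> P"
    then have "q ^ n + (p ^ n - q ^ n) \<in> P" using * is_idealD(2)[OF I] by blast
    then show "p ^ n \<in> P" by simp
  qed
  then show False using pq prime_ideal_power_iff[OF P] assms(2) by blast
qed

text \<open>The multipliers \<open>D * r\<close> and \<open>D * s\<close> are invertible at
  \<open>P\<close>, so \<open>p\<close> and \<open>q\<close> lie in the localised ideal; taking
  \<open>n\<close>-th powers gains order \<open>n\<close>.\<close>

lemma locally_in_power_pair:
  assumes P: "is_prime_ideal P" and I: "is_ideal I"
    and "D \<notin> P" "r \<notin> P" "s \<notin> P" "D * p * r \<in> I" "D * q * s \<in> I"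
  shows "locally_in_power I P n (p ^ n - q ^ n)"
proof -
  have D: "D * r * s \<notin> P" using assms prime_ideal_mult_notin by blast
  have "s * (D * p * r) \<in> I" "r * (D * q * s) \<in> I"
    using assms(6,7) is_idealD(3)[OF I] by blast+
  then have "(D * r * s) * p \<in> I" "(D * r * s) * q \<in> I" by (simp_all add: mult_ac)
  then have "locally_in_power I P 1 p" "locally_in_power I P 1 q" using locally_in_powerI[OF D] by blast+
  then show ?thesis using locally_in_power_power[OF P, of I 1 _ n] locally_in_power_diff[OF P] by simp
qed

lemma locally_in_power_factor:
  assumes "is_prime_ideal P" "locally_in_power I P k f" "m \<le> k * a"
  shows "locally_in_power I P m (f ^ a * g)"
  using locally_in_power_mult[OF assms(1) locally_in_power_power[OF assms(1,2), of a]
      locally_in_power_0[OF assms(1)]] assms(3) locally_in_power_mono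
  by fastforce

lemma locally_in_power_times:
  assumes "is_prime_ideal P" "locally_in_power I P k f"
  shows "locally_in_power I P k (f * g)" "locally_in_power I P k (g * f)"
  using locally_in_power_factor[OF assms, of k 1 g] by (simp_all add: mult.commute)

lemma FABC_in_symbolic_power:
  assumes n: "n > 0" and m: "m = a + b + c" "m \<le> n * a" "m \<le> n * b" "m \<le> n * c"
  shows "FA n ^ a * FB n ^ b * FC n ^ c \<in> symbolic_power (I_n n) m"
proof -
  have "locally_in_power (I_n n) P m (FA n ^ a * FB n ^ b * FC n ^ c)" if P: "P \<in> Ass (I_n n)" for P
  proof -
    have prime: "is_prime_ideal P" using P by (simp add: Ass_def)
    note triple = Ass_vars[OF n P]
    note D = prime_ideal_mult_notin[OF prime power_diff_notin[OF prime n] power_diff_notin[OF prime n]]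
    note gens = I_n_generators[of n]
    let ?i = "\<lambda>v. Var v \<in> P"
    have few: "\<not> ?i u \<or> \<not> ?i v"
      if "\<not> (?i X \<and> ?i Y \<or> ?i Z \<and> ?i W)" "\<not> (?i X \<and> ?i Z \<or> ?i Y \<and> ?i W)"
        "\<not> (?i X \<and> ?i W \<or> ?i Y \<and> ?i Z)" "u \<noteq> v" for u v
      using that by (cases u; cases v) auto
    \<comment> \<open>A pair of variables in \<open>P\<close> determines which of
      \<open>FA n\<close>, \<open>FB n\<close>, \<open>FC n\<close> has the matching binomial
      factor; that one supplies order \<open>n\<close>, the others are left as cofactors.\<close>
    consider (A) "?i X \<and> ?i Y \<or> ?i Z \<and> ?i W" | (B) "?i X \<and> ?i Z \<or> ?i Y \<and> ?i W"
      | (C) "?i X \<and> ?i W \<or> ?i Y \<and> ?i Z"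
      | (N) "\<And>u v. u \<noteq> v \<Longrightarrow> \<not> ?i u \<or> \<not> ?i v"
      using few by blast
    then show ?thesis
    proof cases
      case A
      \<comment> \<open>With exactly two variables in \<open>P\<close>, each binomial of
        \<open>FB n\<close> has exactly one of its two variables in \<open>P\<close>.\<close>
      then have "FB n \<notin> P"
        unfolding FB_def using triple[of X Y Z] triple[of X Y W] triple[of X Z W] triple[of Y Z W]
        by (intro D) auto
      have "locally_in_power (I_n n) P n (FA n)"
        using A
      proof
        assume *: "?i X \<and> ?i Y"
        have "locally_in_power (I_n n) P n (Var X ^ n - Var Y ^ n)"
          by (rule locally_in_power_pair[OF prime is_ideal_I_n \<open>FB n \<notin> P\<close>, of "Var Z" "Var W"])
            (use * gens triple[of X Y Z] triple[of X Y W] in auto)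
        then show ?thesis unfolding FA_def by (rule locally_in_power_times[OF prime])
      next
        assume *: "?i Z \<and> ?i W"
        have "locally_in_power (I_n n) P n (Var Z ^ n - Var W ^ n)"
          by (rule locally_in_power_pair[OF prime is_ideal_I_n \<open>FB n \<notin> P\<close>, of "Var X" "Var Y"])
            (use * gens triple[of X Z W] triple[of Y Z W] in \<open>auto simp: mult_ac\<close>)
        then show ?thesis unfolding FA_def by (rule locally_in_power_times[OF prime])
      qed
      from locally_in_power_factor[OF prime this m(2), of "FB n ^ b * FC n ^ c"]
      show ?thesis by (simp add: mult_ac)
    next
      case B
      then have "FA n \<notin> P"
        unfolding FA_def using triple[of X Y Z] triple[of X Y W] triple[of X Z W] triple[of Y Z W]
        by (intro D) auto
      have "locally_in_power (I_n n) P n (FB n)"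
        using B
      proof
        assume *: "?i X \<and> ?i Z"
        have "locally_in_power (I_n n) P n (Var X ^ n - Var Z ^ n)"
          by (rule locally_in_power_pair[OF prime is_ideal_I_n \<open>FA n \<notin> P\<close>, of "Var Y" "Var W"])
            (use * gens triple[of X Y Z] triple[of X Z W] in auto)
        then show ?thesis unfolding FB_def by (rule locally_in_power_times[OF prime])
      next
        assume *: "?i Y \<and> ?i W"
        have "locally_in_power (I_n n) P n (Var Y ^ n - Var W ^ n)"
          by (rule locally_in_power_pair[OF prime is_ideal_I_n \<open>FA n \<notin> P\<close>, of "Var X" "Var Z"])
            (use * gens triple[of X Y W] triple[of Y Z W] in \<open>auto simp: mult_ac\<close>)
        then show ?thesis unfolding FB_def by (rule locally_in_power_times[OF prime])
      qed
      from locally_in_power_factor[OF prime this m(3), of "FA n ^ a * FC n ^ c"]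
      show ?thesis by (simp add: mult_ac)
    next
      case C
      then have "FA n \<notin> P"
        unfolding FA_def using triple[of X Y Z] triple[of X Y W] triple[of X Z W] triple[of Y Z W]
        by (intro D) auto
      have "locally_in_power (I_n n) P n (FC n)"
        using C
      proof
        assume *: "?i X \<and> ?i W"
        have "locally_in_power (I_n n) P n (Var X ^ n - Var W ^ n)"
          by (rule locally_in_power_pair[OF prime is_ideal_I_n \<open>FA n \<notin> P\<close>, of "Var Y" "Var Z"])
            (use * gens triple[of X Y W] triple[of X Z W] in \<open>auto simp: mult_ac\<close>)
        then show ?thesis unfolding FC_def by (rule locally_in_power_times[OF prime])
      next
        assume *: "?i Y \<and> ?i Z"
        have "locally_in_power (I_n n) P n (Var Y ^ n - Var Z ^ n)"
          by (rule locally_in_power_pair[OF prime is_ideal_I_n \<open>FA n \<notin> P\<close>, of "Var X" "Var W"])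
            (use * gens triple[of X Y Z] triple[of Y Z W] in \<open>auto simp: mult_ac\<close>)
        then show ?thesis unfolding FC_def by (rule locally_in_power_times[OF prime])
      qed
      from locally_in_power_factor[OF prime this m(4), of "FA n ^ a * FB n ^ b"]
      show ?thesis by (simp add: mult_ac)
    next
      case N
      \<comment> \<open>Each of the three forms is carried into the ideal by two monomials in
        disjoint pairs of variables. With at most one variable in \<open>P\<close>, one of these
        monomials is outside \<open>P\<close>; the exponents then add up to
        \<open>m\<close>.\<close>
      have one: "locally_in_power (I_n n) P 1 D"
        if "D * Var u * Var v \<in> I_n n" "D * Var u' * Var v' \<in> I_n n" "distinct [u, v, u', v']" for D u v u' v'
      proof -
        have "Var u * Var v \<notin> P \<or> Var u' * Var v' \<notin> P"
          using N[of u u'] N[of u v'] N[of v u'] N[of v v'] that(3) prime_ideal_mult_notin[OF prime]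
          by (metis distinct_length_2_or_more)
        then show ?thesis
          using that(1,2) locally_in_powerI[of "Var u * Var v"] locally_in_powerI[of "Var u' * Var v'"]
          by (auto simp: mult_ac)
      qed
      have "locally_in_power (I_n n) P 1 (FA n)" "locally_in_power (I_n n) P 1 (FB n)"
        "locally_in_power (I_n n) P 1 (FC n)"
        using one[OF gens(1,2)] one[OF gens(3,4)] one[OF gens(5,6)] by simp_all
      then have "locally_in_power (I_n n) P (1 * a + 1 * b + 1 * c) (FA n ^ a * FB n ^ b * FC n ^ c)"
        by (intro locally_in_power_mult locally_in_power_power prime)
      then show ?thesis by (simp add: m(1))
    qed
  qed
  then show ?thesis
    unfolding symbolic_power_def locally_in_power_def by blast
qed

lemma power_diff_nonzero:
  assumes "u \<noteq> v" "n > 0"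
  shows "Var u ^ n - Var v ^ n \<noteq> 0"
  by (rule eval_at_neq_0D[of "\<lambda>w. if w = u then 1 else 0"]) (use assms in \<open>simp add: power_0_left\<close>)

lemma FABC_nonzero: "n > 0 \<Longrightarrow> FA n \<noteq> 0 \<and> FB n \<noteq> 0 \<and> FC n \<noteq> 0"
  using power_diff_nonzero[of _ _ n] by (simp add: FA_def FB_def FC_def)

lemma homog_FABC: "homog_of_deg (2 * n) (FA n)" "homog_of_deg (2 * n) (FB n)" "homog_of_deg (2 * n) (FC n)"
proof -
  have "homog_of_deg (1 * n + 1 * n) ((Var u ^ n - Var v ^ n) * (Var u' ^ n - Var v' ^ n))" for u v u' v'
    by (intro homog_mult homog_diff homog_power homog_Var)
  then show "homog_of_deg (2 * n) (FA n)" "homog_of_deg (2 * n) (FB n)" "homog_of_deg (2 * n) (FC n)"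
    by (simp_all add: FA_def FB_def FC_def mult_2)
qed

subsection \<open>The lower bound\<close>

fun line_A :: "bool \<times> complex \<Rightarrow> mpoly" where
  "line_A (True, c) = Var X - Const c * Var Y"
| "line_A (False, c) = Var Z - Const c * Var W"

fun line_C :: "bool \<times> complex \<Rightarrow> mpoly" where
  "line_C (True, c) = Var X - Const c * Var W"
| "line_C (False, c) = Var Y - Const c * Var Z"

fun line_subst :: "bool \<times> complex \<Rightarrow> var \<Rightarrow> mpoly" where
  "line_subst (True, c) = (Var)(X := Const c * Var Y)"
| "line_subst (False, c) = (Var)(Z := Const c * Var W)"

text \<open>A point of the line \<open>line_A i = line_C j = 0\<close> at which no other \<open>line_A\<close> or \<open>line_C\<close> and no
  variable vanishes.\<close>

fun line_point :: "bool \<times> complex \<Rightarrow> bool \<times> complex \<Rightarrow> var \<Rightarrow> complex" where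
  "line_point (True, c) (True, d) = (\<lambda>v. case v of X \<Rightarrow> d | Y \<Rightarrow> d / c | Z \<Rightarrow> 2 | W \<Rightarrow> 1)"
| "line_point (True, c) (False, d) = (\<lambda>v. case v of X \<Rightarrow> c * d | Y \<Rightarrow> d | Z \<Rightarrow> 1 | W \<Rightarrow> 2)"
| "line_point (False, c) (True, d) = (\<lambda>v. case v of X \<Rightarrow> d | Y \<Rightarrow> 2 | Z \<Rightarrow> c | W \<Rightarrow> 1)"
| "line_point (False, c) (False, d) = (\<lambda>v. case v of X \<Rightarrow> 2 | Y \<Rightarrow> d * c | Z \<Rightarrow> c | W \<Rightarrow> 1)"

lemma line_grid_Fermat:
  assumes n: "n > 0"
  defines "I \<equiv> UNIV \<times> unity_roots n"
  shows "line_grid I I line_A line_C line_subst line_point"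
proof
  have fin: "finite I" unfolding I_def using finite_unity_roots[OF n] by simp
  then show "finite I" .
  \<comment> \<open>The points of the grid mix roots of unity with the value 2, so comparing
    absolute values rules out the forms in the wrong pair of variables.\<close>
  have norm: "norm (snd i) = 1" if "i \<in> I" for i
    using norm_unity_root[OF n] that by (auto simp: I_def)
  have lf: "linear_form (line_A i) (line_subst i)" for i
    by (cases i rule: line_A.cases) (auto intro: linear_form_root)
  then show "linear_form (line_A i) (line_subst i)" for i .
  show "homog_of_deg 1 (line_C j)" for j
    using linear_form_root[of W X] linear_form_root[of Z Y]
    by (cases j rule: line_C.cases) (auto simp: linear_form_def)
  show "prime_elem (subst (line_subst i) (line_C j))" if "i \<in> I" "j \<in> I" for i j
  proof -
    have nz: "snd i \<noteq> 0" using norm[OF that(1)] by auto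
    \<comment> \<open>Eliminating \<open>X\<close> or \<open>Z\<close> turns each
      \<open>line_C j\<close> into such a two-variable form with nonzero leading
      coefficient.\<close>
    have 1: "prime_elem (Const a * Var v - Const b * Var u)" if "a \<noteq> 0" "u \<noteq> v" for a b u v
      using linear_form_prime[OF linear_form_diff[OF that]] .
    show ?thesis
      using nz 1[of _ W Y] 1[of 1 Z Y] 1[of 1 W X] 1[of 1 W Y]
      by (cases i rule: line_A.cases; cases j rule: line_C.cases)
        (auto simp: mult.assoc[symmetric] simp flip: Const_simps(4))
  qed
  show "eval_at (line_point i j) (line_A i') = 0 \<longleftrightarrow> i' = i" if "i \<in> I" "j \<in> I" "i' \<in> I" for i j i'
  proof -
    have N: "norm (snd i) = 1" "norm (snd j) = 1" "norm (snd i') = 1"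
      using norm that by auto
    then have nz: "snd i \<noteq> 0" "snd j \<noteq> 0" "snd i' \<noteq> 0" by auto
    then show ?thesis
      using N
      by (cases i rule: line_A.cases; cases j rule: line_C.cases; cases i' rule: line_A.cases)
        (auto simp: divide_simps norm_mult norm_divide dest: arg_cong[of _ _ norm])
  qed
  show "eval_at (line_point i j) (line_C j') = 0 \<longleftrightarrow> j' = j" if "i \<in> I" "j \<in> I" "j' \<in> I" for i j j'
  proof -
    have N: "norm (snd i) = 1" "norm (snd j) = 1" "norm (snd j') = 1"
      using norm that by auto
    then have nz: "snd i \<noteq> 0" "snd j \<noteq> 0" "snd j' \<noteq> 0" by auto
    then show ?thesis
      using N
      by (cases i rule: line_A.cases; cases j rule: line_C.cases; cases j' rule: line_C.cases)
        (auto simp: divide_simps norm_mult norm_divide dest: arg_cong[of _ _ norm])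
  qed
qed (simp_all add: I_def finite_unity_roots n)

lemma prod_UNIV_times:
  "(\<Prod>i\<in>UNIV \<times> U. f i) = (\<Prod>c\<in>U. f (True, c)) * (\<Prod>c\<in>U. f (False, c))"
  by (simp add: prod.cartesian_product' UNIV_bool mult.commute)

lemma FA_FC_factorization:
  assumes "n > 0"
  shows "\<exists>e. e \<noteq> 0 \<and> FA n = Const e * (\<Prod>i\<in>UNIV \<times> unity_roots n. line_A i)"
    and "\<exists>e. e \<noteq> 0 \<and> FC n = Const e * (\<Prod>i\<in>UNIV \<times> unity_roots n. line_C i)"
proof -
  note f = power_diff_factorization[OF _ assms]
  obtain e1 e2 e3 e4 where e: "e1 \<noteq> 0" "e2 \<noteq> 0" "e3 \<noteq> 0" "e4 \<noteq> 0" and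
    eq: "Var X ^ n - Var Y ^ n = Const e1 * (\<Prod>c\<in>unity_roots n. Var X - Const c * Var Y)"
    "Var Z ^ n - Var W ^ n = Const e2 * (\<Prod>c\<in>unity_roots n. Var Z - Const c * Var W)"
    "Var X ^ n - Var W ^ n = Const e3 * (\<Prod>c\<in>unity_roots n. Var X - Const c * Var W)"
    "Var Y ^ n - Var Z ^ n = Const e4 * (\<Prod>c\<in>unity_roots n. Var Y - Const c * Var Z)"
    using f[of Y X] f[of W Z] f[of W X] f[of Z Y] by auto
  show "\<exists>e. e \<noteq> 0 \<and> FA n = Const e * (\<Prod>i\<in>UNIV \<times> unity_roots n. line_A i)"
    by (rule exI[of _ "e1 * e2"]) (use e in \<open>simp add: FA_def eq(1,2) prod_UNIV_times\<close>)
  show "\<exists>e. e \<noteq> 0 \<and> FC n = Const e * (\<Prod>i\<in>UNIV \<times> unity_roots n. line_C i)"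
    by (rule exI[of _ "e3 * e4"]) (use e in \<open>simp add: FC_def eq(3,4) prod_UNIV_times\<close>)
qed

lemma symbolic_power_degree_bound:
  assumes n: "n > 0" and f: "f \<in> symbolic_power (I_n n) m" "f \<noteq> 0" "homog_of_deg d f"
  shows "2 * n * m \<le> d"
proof -
  define I :: "(bool \<times> complex) set" where "I = UNIV \<times> unity_roots n"
  interpret line_grid I I line_A line_C line_subst line_point
    unfolding I_def by (rule line_grid_Fermat[OF n])
  obtain a c where a: "a \<noteq> 0" "FA n = Const a * (\<Prod>i\<in>I. line_A i)"
    and c: "c \<noteq> 0" "FC n = Const c * (\<Prod>i\<in>I. line_C i)"
    using FA_FC_factorization[OF n] unfolding I_def by blast
  have "vanishes (line_A i) (line_C j) m f" if ij: "i \<in> I" "j \<in> I" for i j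
  proof -
    let ?P = "ideal2 (line_A i) (line_C j)"
    define A' where "A' = Const a * (\<Prod>i'\<in>I - {i}. line_A i')"
    define C' where "C' = Const c * (\<Prod>j'\<in>I - {j}. line_C j')"
    have A: "FA n = line_A i * A'"
      using prod.remove[OF finite(1) ij(1), of line_A] by (simp add: a A'_def mult_ac)
    have C: "FC n = line_C j * C'"
      using prod.remove[OF finite(1) ij(2), of line_C] by (simp add: c C'_def mult_ac)
    have sub: "I_n n \<subseteq> ?P"
      using ideal2I[of A' "line_A i" 0 "line_C j"] ideal2I[of 0 "line_A i" C' "line_C j"]
      by (intro I_n_subset is_ideal_ideal2) (simp_all add: A C mult.commute)
    have "snd i \<noteq> 0" "snd j \<noteq> 0"
      using ij unity_root_nonzero[OF n] by (auto simp: I_def)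
    then have pt: "line_point i j v \<noteq> 0" for v
      by (cases i rule: line_A.cases; cases j rule: line_C.cases; cases v) auto
    \<comment> \<open>This \<open>?g\<close> exhibits the line as an associated prime. It is nonzero
      at the point of the line, while \<open>line_A i\<close> completes \<open>A'\<close> to
      \<open>FA n\<close> and \<open>line_C j\<close> completes \<open>C'\<close> to
      \<open>FC n\<close>, giving multiples of generators.\<close>
    let ?g = "A' * C' * Var X * Var Y * Var Z * Var W"
    have "eval_at (line_point i j) ?g \<noteq> 0"
      using pt pt_l[OF ij] pt_l'[OF ij] a c finite(1) by (auto simp: A'_def C'_def)
    then have g: "?g \<notin> ?P"
      using eval_at_ideal2 pt_l[OF ij ij(1)] pt_l'[OF ij ij(2)] by blast
    have "line_A i * ?g = (C' * Var Z * Var W) * (FA n * Var X * Var Y)"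
      "line_C j * ?g = (A' * Var Y * Var Z) * (FC n * Var X * Var W)"
      by (simp_all add: A C mult_ac)
    then have "line_A i * ?g \<in> I_n n" "line_C j * ?g \<in> I_n n"
      using is_idealD(3)[OF is_ideal_I_n] I_n_generators by metis+
    then have "?P \<in> Ass (I_n n)"
      using line_in_Ass[OF ij is_ideal_I_n sub g] by blast
    then show ?thesis
      using f(1) ideal_power_subset_pow2[OF sub, of m] unfolding symbolic_power_def vanishes_def by blast
  qed
  then have "card I * m \<le> d" using degree_bound[OF f(2,3)] by blast
  then show ?thesis by (simp add: I_def card_unity_roots[OF n] card_cartesian_product)
qed

theorem theorem3p2:
  fixes n m :: nat
  assumes "n \<ge> 5" and "m \<ge> 3"
  shows "alpha (symbolic_power (I_n n) m) = 2 * n * m"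
  unfolding alpha_def
proof (rule Least_equality)
  have n: "n > 0" using assms by simp
  \<comment> \<open>The exponents \<open>b + r\<close>, \<open>b\<close>, \<open>b\<close> add up to
    \<open>m\<close>. As \<open>m\<close> is at least 3, \<open>b\<close> is positive, so
    \<open>r <= 2 <= 2 * b\<close> and \<open>m = 3 * b + r\<close> is at most \<open>5 * b\<close>;
    this is where \<open>n\<close> being at least 5 enters.\<close>
  define b r where "b = m div 3" and "r = m mod 3"
  have r: "m = 3 * b + r" "r < 3" and b: "b \<ge> 1"
    unfolding b_def r_def using assms(2) div_le_mono[of 3 m 3] by simp_all
  define a where "a = b + r"
  have m: "m = a + b + b" and "m \<le> 5 * a" "m \<le> 5 * b"
    using r b by (simp_all add: a_def)
  from this(2,3) have le: "m \<le> n * a" "m \<le> n * b"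
    using mult_le_mono1[OF assms(1)] le_trans by blast+
  let ?f = "FA n ^ a * FB n ^ b * FC n ^ b"
  have "homog_of_deg (2 * n * a + 2 * n * b + 2 * n * b) ?f"
    by (intro homog_mult homog_power homog_FABC)
  then have "homog_of_deg (2 * n * m) ?f" by (simp add: m algebra_simps)
  then show "\<exists>p\<in>symbolic_power (I_n n) m. p \<noteq> 0 \<and> homog_of_deg (2 * n * m) p"
    using FABC_in_symbolic_power[OF n m le le(2)] FABC_nonzero[OF n] by (intro bexI[of _ ?f]) auto
qed (use assms symbolic_power_degree_bound in auto)

end
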